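(* Let $\mathcal{P}$ be the Cauchy transform on the unit disk defined below. For $p>2$, with $q=p/(p-1)$ the conjugate exponent of $p$, $$\|\mathcal{P}\|_{L^p\to L^{\infty}}=2\left(\frac{\Gamma(2-q)}{\Gamma^2(2-\frac{q}{2})}\right)^{1/q},$$ where $\Gamma$ is the Gamma function. In particular, for $p=\infty$, $\|\mathcal{P}\|_{L^\infty\to L^\infty}=\frac{8}{\pi}$.
   Context: $\mathbb{D}=\{z\in\mathbb{C}:|z|<1\}$ and $\mathrm{d}A(z)=\frac{1}{\pi}\,\mathrm{d}x\,\mathrm{d}y$ is the normalized area measure; $L^p=L^p(\mathbb{D},\mathrm{d}A)$ with $\|\varphi\|_p=(\int_{\mathbb{D}}|\varphi|^p\mathrm{d}A)^{1/p}$ and $\|\varphi\|_\infty$ the essential supremum. For $\varphi\in L^p(\mathbb{D},\mathrm{d}A)$ and $z\in\mathbb{D}$, $$\mathcal{P}[\varphi](z)=-\int_{\mathbb{D}}\left(\frac{\varphi(w)}{w-z}+\frac{z\overline{\varphi(w)}}{1-\bar{w}z}\right)\mathrm{d}A(w).$$ The operator norm is $\|\mathcal{P}\|_{L^p\to L^\infty}=\sup\{\|\mathcal{P}[\varphi]\|_\infty:\|\varphi\|_p=1\}$. *)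

theory Defs
  imports "HOL-Analysis.Analysis" "HOL-Probability.Essential_Supremum"
begin

definition dA :: "complex measure" where
  "dA = density (lebesgue_on (ball 0 1)) (\<lambda>_. ennreal (1 / pi))"

definition in_Lp :: "real \<Rightarrow> (complex \<Rightarrow> complex) \<Rightarrow> bool" where
  "in_Lp p \<phi> \<longleftrightarrow> \<phi> \<in> borel_measurable dA \<and> integrable dA (\<lambda>w. norm (\<phi> w) powr p)"

definition Lp_norm :: "real \<Rightarrow> (complex \<Rightarrow> complex) \<Rightarrow> real" where
  "Lp_norm p \<phi> = (LINT w|dA. norm (\<phi> w) powr p) powr (1 / p)"

definition Linf_norm :: "(complex \<Rightarrow> complex) \<Rightarrow> ereal" where
  "Linf_norm \<phi> = esssup dA (\<lambda>w. ereal (norm (\<phi> w)))"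

definition cauchyP :: "(complex \<Rightarrow> complex) \<Rightarrow> complex \<Rightarrow> complex" where
  "cauchyP \<phi> z = - (LINT w|dA. \<phi> w / (w - z) + z * cnj (\<phi> w) / (1 - cnj w * z))"

definition opnorm_Lp_Linf :: "real \<Rightarrow> ereal" where
  "opnorm_Lp_Linf p = (SUP \<phi> \<in> {\<phi>. in_Lp p \<phi> \<and> Lp_norm p \<phi> = 1}. Linf_norm (cauchyP \<phi>))"

definition opnorm_Linf_Linf :: "ereal" where
  "opnorm_Linf_Linf = (SUP \<phi> \<in> {\<phi>. \<phi> \<in> borel_measurable dA \<and> Linf_norm \<phi> = 1}. Linf_norm (cauchyP \<phi>))"

end

theory Submission
  imports Defs "HOL-Real_Asymp.Real_Asymp"
begin

text \<open>
  Write \<open>q = 2a\<close> and \<open>U(z) = \<integral> |w - z|\<^sup>-\<^sup>q dA(w)\<close>. At \<open>z\<close> the kernel is dominated by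
  \<open>|\<phi>(w)| (1 / |w - z| + |z| / |1 - cnj w z|)\<close>, and the \<open>q\<close>-th power of the second summand integrates
  to \<open>U(1 / cnj z)\<close>. By Young's inequality the upper bound follows from
  \<open>U(z) + U(1 / cnj z) \<le> 2 U(1)\<close>. Averaging over circles expands \<open>U\<close> in powers of \<open>x = |z|\<^sup>2\<close> with
  coefficients \<open>d n = ((a)\<^sub>n / n!)\<^sup>2\<close>: one gets \<open>U(1 / cnj z) = \<Sum> d n x\<^bsup>a+n\<^esup> / (n + 1)\<close> and, because a
  telescoping sum kills the coefficient of \<open>x\<^bsup>1-a\<^esup>\<close>, \<open>U(z) = \<Sum> d n x\<^sup>n / (1 - a - n)\<close>. Pairing the
  \<open>(n+1)\<close>-st term of the latter with the \<open>n\<close>-th term of the former, the inequality holds term by term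
  by Bernoulli. The value \<open>U(1)\<close> is a Beta integral. The bound is attained in the limit at
  the boundary point \<open>z = 1\<close>, where both parts of the kernel coincide up to conjugation.
\<close>

section \<open>The normalized area measure of the disk\<close>

text \<open>The two potentials compete. In the series of U(z) every coefficient with n >= 1 is
  negative, so U(z) > U(1) inside the disk, while U(1 / cnj z) grows with |z| towards U(1); only
  their sum can be bounded by 2 U(1). The pairing works because \<open>d (n+1)\<close> is
  \<open>d n\<close> times ((n + a) / (n + 1))^2: the excess of one series over U(1) and the deficit
  of the other then differ, in the n-th pair, by the ratio (n + a) / (n + 1) of the two exponents of
  x, which is the constant of Bernoulli's inequality. Young's inequality is chosen over Hoelder's
  because it is linear in the potentials and so needs nothing but their sum. The squares in
  \<open>d n\<close> come from Parseval's identity, as |1 - v|^(-2a) is the squared modulus of (1 -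
  v)^(-a). Rotation invariance of area and the uniform law of |w|^2 replace polar coordinates. For
  the lower bound the obstacle is that the point 1 is not in the disk and that an essential supremum
  ignores single points, so continuity of the transform at 1 has to be secured first.\<close>

lemma space_dA: "space dA = ball 0 1"
  by (simp add: dA_def)

lemma sets_dA: "sets dA = sets (lebesgue_on (ball 0 1))"
  by (simp add: dA_def)

lemma borel_measurable_cnj: "cnj \<in> borel_measurable borel"
  by (intro borel_measurable_continuous_onI continuous_intros)

lemma borel_measurable_dA: "f \<in> borel_measurable borel \<Longrightarrow> f \<in> borel_measurable dA"
  by (simp add: measurable_cong_sets[OF sets_dA refl] measurable_completion measurable_restrict_space1)

lemma nn_integral_dA:
  fixes f :: "complex \<Rightarrow> ennreal"
  assumes [measurable]: "f \<in> borel_measurable borel"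
  shows "(\<integral>\<^sup>+w. f w \<partial>dA) = ennreal (1 / pi) * (\<integral>\<^sup>+w. f w * indicator (ball 0 1) w \<partial>lborel)"
proof -
  have m: "f \<in> borel_measurable (lebesgue_on (ball 0 1))"
    by (intro measurable_restrict_space1 measurable_completion) simp
  have "(\<integral>\<^sup>+w. f w \<partial>dA) = (\<integral>\<^sup>+w. ennreal (1 / pi) * f w \<partial>lebesgue_on (ball 0 1))"
    unfolding dA_def using m by (intro nn_integral_density) auto
  also have "\<dots> = ennreal (1 / pi) * (\<integral>\<^sup>+w. f w \<partial>lebesgue_on (ball 0 1))"
    using m by (rule nn_integral_cmult)
  also have "(\<integral>\<^sup>+w. f w \<partial>lebesgue_on (ball 0 1)) = (\<integral>\<^sup>+w. f w * indicator (ball 0 1) w \<partial>lebesgue)"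
    by (intro nn_integral_restrict_space) simp
  also have "\<dots> = (\<integral>\<^sup>+w. f w * indicator (ball 0 1) w \<partial>lborel)"
    by (rule nn_integral_completion)
  finally show ?thesis .
qed

lemma emeasure_dA:
  assumes "S \<in> sets borel" "S \<subseteq> ball 0 1"
  shows "S \<in> sets dA" "emeasure dA S = ennreal (1 / pi) * emeasure lborel S"
proof -
  have "S \<inter> ball 0 1 = S" "S \<in> sets lebesgue" using assms by (auto intro: lborelD)
  then show s: "S \<in> sets dA"
    by (auto simp: sets_dA sets_restrict_space intro!: image_eqI[of _ _ S])
  have i: "indicator S \<in> borel_measurable (borel :: complex measure)"
    using assms by simp
  have "emeasure dA S = (\<integral>\<^sup>+w. indicator S w \<partial>dA)"
    using s by simp
  also have "\<dots> = ennreal (1 / pi) * (\<integral>\<^sup>+w. indicator S w * indicator (ball 0 1) w \<partial>lborel)"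
    by (rule nn_integral_dA[OF i])
  also have "(\<lambda>w. indicator S w * indicator (ball 0 1) w :: ennreal) = indicator S"
    using assms by (auto simp: fun_eq_iff split: split_indicator)
  finally show "emeasure dA S = ennreal (1 / pi) * emeasure lborel S"
    using assms by simp
qed

lemma emeasure_dA_space: "emeasure dA (space dA) = 1"
  using emeasure_dA(2)[of "ball 0 1"] emeasure_ball[of 1 "0::complex"]
  by (simp add: space_dA unit_ball_vol_2 ennreal_mult[symmetric])

lemma finite_measure_dA: "finite_measure dA"
  by (intro finite_measureI) (simp add: emeasure_dA_space)

interpretation dA: finite_measure dA by (rule finite_measure_dA)

section \<open>Tonelli's theorem in real coordinates, and rotation invariance of area\<close>

lemma measurable_Complex_pair:
  "(\<lambda>(x, y). Complex x y) \<in> lborel \<Otimes>\<^sub>M lborel \<rightarrow>\<^sub>M borel"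
proof -
  have "(\<lambda>p. complex_of_real (fst p) + \<i> * complex_of_real (snd p)) \<in> lborel \<Otimes>\<^sub>M lborel \<rightarrow>\<^sub>M borel"
    by measurable
  then show ?thesis by (simp add: Complex_eq case_prod_beta')
qed

text \<open>Lebesgue measure is determined by its values on open boxes, and a box in the plane is a
  product of two intervals. This opens the way to iterated integrals over real and imaginary
  parts.\<close>

lemma lborel_complex_eq_distr:
  "lborel = distr (lborel \<Otimes>\<^sub>M lborel) borel (\<lambda>(x, y). Complex x y)"
proof (rule lborel_eqI)
  fix l u :: complex assume le: "\<And>b. b \<in> Basis \<Longrightarrow> l \<bullet> b \<le> u \<bullet> b"
  then have le': "Re l \<le> Re u" "Im l \<le> Im u" using le[of 1] le[of \<i>] by (simp_all add: Basis_complex_def)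
  have "(\<lambda>(x, y). Complex x y) -` box l u \<inter> space (lborel \<Otimes>\<^sub>M lborel) = {Re l<..<Re u} \<times> {Im l<..<Im u}"
    by (auto simp: box_def Basis_complex_def space_pair_measure)
  then show "emeasure (distr (lborel \<Otimes>\<^sub>M lborel) borel (\<lambda>(x, y). Complex x y)) (box l u) = (\<Prod>b\<in>Basis. (u - l) \<bullet> b)"
    using le' by (subst emeasure_distr[OF measurable_Complex_pair])
      (auto simp: lborel.emeasure_pair_measure_Times Basis_complex_def ennreal_mult)
qed simp

lemma nn_integral_lborel_complex:
  fixes f :: "complex \<Rightarrow> ennreal"
  assumes [measurable]: "f \<in> borel_measurable borel"
  shows "(\<integral>\<^sup>+w. f w \<partial>lborel) = (\<integral>\<^sup>+x. (\<integral>\<^sup>+y. f (Complex x y) \<partial>lborel) \<partial>lborel)"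
    and "(\<integral>\<^sup>+w. f w \<partial>lborel) = (\<integral>\<^sup>+y. (\<integral>\<^sup>+x. f (Complex x y) \<partial>lborel) \<partial>lborel)"
proof -
  note m [measurable] = measurable_Complex_pair
  have m2: "(\<lambda>p. f (case p of (x, y) \<Rightarrow> Complex x y)) \<in> borel_measurable (lborel \<Otimes>\<^sub>M lborel)"
    by measurable
  have "(\<integral>\<^sup>+w. f w \<partial>lborel) = (\<integral>\<^sup>+w. f w \<partial>distr (lborel \<Otimes>\<^sub>M lborel) borel (\<lambda>(x, y). Complex x y))"
    by (simp only: lborel_complex_eq_distr[symmetric])
  also have "\<dots> = (\<integral>\<^sup>+p. f (case p of (x, y) \<Rightarrow> Complex x y) \<partial>(lborel \<Otimes>\<^sub>M lborel))"
    by (rule nn_integral_distr) (use m in auto)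
  finally have eq: "(\<integral>\<^sup>+w. f w \<partial>lborel) = \<dots>" .
  show "(\<integral>\<^sup>+w. f w \<partial>lborel) = (\<integral>\<^sup>+x. (\<integral>\<^sup>+y. f (Complex x y) \<partial>lborel) \<partial>lborel)"
    unfolding eq using lborel.nn_integral_fst[OF m2] by simp
  show "(\<integral>\<^sup>+w. f w \<partial>lborel) = (\<integral>\<^sup>+y. (\<integral>\<^sup>+x. f (Complex x y) \<partial>lborel) \<partial>lborel)"
    unfolding eq using lborel_pair.nn_integral_snd[OF m2] by simp
qed

text \<open>A shear moves each line parallel to one axis along itself, so the inner integral in that
  direction changes only by a translation. The two shears call for the two orders of
  integration.\<close>

lemma nn_integral_lborel_complex_shear:
  fixes f :: "complex \<Rightarrow> ennreal"
  assumes [measurable]: "f \<in> borel_measurable borel"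
  shows "(\<integral>\<^sup>+w. f (w + of_real (c * Im w)) \<partial>lborel) = (\<integral>\<^sup>+w. f w \<partial>lborel)"
    and "(\<integral>\<^sup>+w. f (w + \<i> * of_real (c * Re w)) \<partial>lborel) = (\<integral>\<^sup>+w. f w \<partial>lborel)"
proof -
  have C [measurable]: "(\<lambda>x. Complex x y) \<in> borel_measurable borel" "Complex x \<in> borel_measurable borel" for x y
    by (intro borel_measurable_continuous_onI continuous_intros)+
  have [measurable]: "(\<lambda>w. w + of_real (c * Im w)) \<in> borel_measurable borel" "(\<lambda>w. w + \<i> * of_real (c * Re w)) \<in> borel_measurable borel"
    by measurable
  have *: "(\<integral>\<^sup>+x. g (x + t) \<partial>lborel) = (\<integral>\<^sup>+x. g x \<partial>lborel)"
    if "g \<in> borel_measurable borel" for g :: "real \<Rightarrow> ennreal" and t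
    using nn_integral_real_affine[OF that, of 1 t] by (simp add: add.commute)
  have "(\<integral>\<^sup>+w. f (w + of_real (c * Im w)) \<partial>lborel)
      = (\<integral>\<^sup>+y. (\<integral>\<^sup>+x. f (Complex (x + c * y) y) \<partial>lborel) \<partial>lborel)"
    by (subst nn_integral_lborel_complex(2), measurable) (auto simp: complex_of_real_def plus_complex.code)
  also have "\<dots> = (\<integral>\<^sup>+y. (\<integral>\<^sup>+x. f (Complex x y) \<partial>lborel) \<partial>lborel)"
    by (subst *[where g = "\<lambda>x. f (Complex x _)"]) simp_all
  finally show "(\<integral>\<^sup>+w. f (w + of_real (c * Im w)) \<partial>lborel) = (\<integral>\<^sup>+w. f w \<partial>lborel)"
    by (subst (asm) nn_integral_lborel_complex(2)[symmetric]) simp_all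
  have "(\<integral>\<^sup>+w. f (w + \<i> * of_real (c * Re w)) \<partial>lborel)
      = (\<integral>\<^sup>+x. (\<integral>\<^sup>+y. f (Complex x (y + c * x)) \<partial>lborel) \<partial>lborel)"
    by (subst nn_integral_lborel_complex(1), measurable) (auto simp: complex_of_real_def i_complex_of_real plus_complex.code)
  also have "\<dots> = (\<integral>\<^sup>+x. (\<integral>\<^sup>+y. f (Complex x y) \<partial>lborel) \<partial>lborel)"
    by (subst *[where g = "\<lambda>y. f (Complex _ y)"]) simp_all
  finally show "(\<integral>\<^sup>+w. f (w + \<i> * of_real (c * Re w)) \<partial>lborel) = (\<integral>\<^sup>+w. f w \<partial>lborel)"
    by (subst (asm) nn_integral_lborel_complex(1)[symmetric]) simp_all
qed

text \<open>A rotation by less than a half turn is a product of three shears.\<close>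

lemma nn_integral_lborel_rotate:
  fixes f :: "complex \<Rightarrow> ennreal"
  assumes [measurable]: "f \<in> borel_measurable borel" and th: "\<bar>\<theta>\<bar> < pi"
  shows "(\<integral>\<^sup>+w. f (cis \<theta> * w) \<partial>lborel) = (\<integral>\<^sup>+w. f w \<partial>lborel)"
proof -
  \<comment> \<open>Multiplying out \<open>S (V (S w))\<close> forces t sin \<theta> = 1 - cos
    \<theta> and t (1 + cos \<theta>) = sin \<theta>, which the half-angle tangent solves. It is
    finite since |\<theta>| < pi keeps cos (\<theta> / 2) away from 0.\<close>
  define t where "t = tan (\<theta> / 2)"
  define S where "S w = w + of_real (- t * Im w)" for w :: complex
  define V where "V w = w + \<i> * of_real (sin \<theta> * Re w)" for w :: complex
  have c: "cos (\<theta> / 2) \<noteq> 0"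
    using th by (intro less_imp_neq[symmetric] cos_gt_zero_pi) auto
  have s2: "sin \<theta> = 2 * sin (\<theta> / 2) * cos (\<theta> / 2)" and c2: "cos \<theta> = 2 * (cos (\<theta> / 2))\<^sup>2 - 1"
    using sin_double[of "\<theta> / 2"] cos_double_cos[of "\<theta> / 2"] by simp_all
  have t1: "t * (1 + cos \<theta>) = sin \<theta>"
    using c unfolding t_def tan_def s2 c2 by (simp add: power2_eq_square)
  have "t * sin \<theta> = 2 * (sin (\<theta> / 2))\<^sup>2"
    using c unfolding t_def tan_def s2 by (simp add: power2_eq_square)
  then have t2: "t * sin \<theta> = 1 - cos \<theta>"
    using c2 by (simp add: sin_squared_eq)
  have rot: "cis \<theta> * w = S (V (S w))" for w
  proof (rule complex_eqI)
    have "Re (S (V (S w))) = (1 - t * sin \<theta>) * (Re w - t * Im w) - t * Im w"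
      by (simp add: S_def V_def algebra_simps)
    also have "\<dots> = cos \<theta> * Re w - (t * (1 + cos \<theta>)) * Im w"
      by (simp add: t2 algebra_simps)
    finally show "Re (cis \<theta> * w) = Re (S (V (S w)))" by (simp add: t1)
    have "Im (S (V (S w))) = sin \<theta> * Re w + (1 - t * sin \<theta>) * Im w"
      by (simp add: S_def V_def algebra_simps)
    then show "Im (cis \<theta> * w) = Im (S (V (S w)))" by (simp add: t2)
  qed
  have [measurable]: "S \<in> borel_measurable borel" "V \<in> borel_measurable borel"
    unfolding S_def V_def by measurable
  have "(\<integral>\<^sup>+w. f (S (V (S w))) \<partial>lborel) = (\<integral>\<^sup>+w. f (S (V w)) \<partial>lborel)"
    using nn_integral_lborel_complex_shear(1)[of "\<lambda>w. f (S (V w))" "-t"] by (simp add: S_def)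
  also have "\<dots> = (\<integral>\<^sup>+w. f (S w) \<partial>lborel)"
    using nn_integral_lborel_complex_shear(2)[of "\<lambda>w. f (S w)" "sin \<theta>"] by (simp add: V_def)
  also have "\<dots> = (\<integral>\<^sup>+w. f w \<partial>lborel)"
    using nn_integral_lborel_complex_shear(1)[of f "-t"] by (simp add: S_def)
  finally show ?thesis by (simp add: rot)
qed

lemma nn_integral_dA_rotate:
  fixes f :: "complex \<Rightarrow> ennreal"
  assumes [measurable]: "f \<in> borel_measurable borel" and th: "\<bar>\<theta>\<bar> < pi"
  shows "(\<integral>\<^sup>+w. f (cis \<theta> * w) \<partial>dA) = (\<integral>\<^sup>+w. f w \<partial>dA)"
  using nn_integral_lborel_rotate[of "\<lambda>w. f w * indicator (ball 0 1) w", OF _ th]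
  by (simp add: nn_integral_dA indicator_def norm_mult)

text \<open>The disk of radius sqrt x has normalized area x, so |w|^2 is uniformly distributed on
  the unit interval. Comparing the two finite measures on the half-lines above x is enough.\<close>

lemma distr_dA_norm_squared:
  "distr dA borel (\<lambda>w. (norm w)\<^sup>2) = density lborel (indicator {0<..<1})"
proof -
  have [measurable]: "(\<lambda>w. (norm w)\<^sup>2) \<in> borel_measurable dA"
    by (intro borel_measurable_dA) measurable
  have D: "emeasure (density lborel (indicator {0<..<1})) A = emeasure lborel ({0<..<1} \<inter> A)"
    if "A \<in> sets borel" for A :: "real set"
    using that by (subst emeasure_density) (auto simp: indicator_inter_arith[symmetric])
  have le: "emeasure (distr dA borel (\<lambda>w. (norm w)\<^sup>2)) {x<..} = emeasure (density lborel (indicator {0<..<1})) {x<..}" for x :: real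
  proof -
    consider "x < 0" | "0 \<le> x" "x < 1" | "1 \<le> x" by linarith
    then show ?thesis
    proof cases
      case 1
      then have "x < y\<^sup>2" for y :: real using zero_le_power2[of y] by linarith
      then have "(\<lambda>w::complex. (norm w)\<^sup>2) -` {x<..} \<inter> space dA = space dA" by auto
      moreover have "{0<..<1} \<inter> {x<..} = {0<..<1}" using 1 by auto
      ultimately show ?thesis by (simp add: emeasure_distr D emeasure_dA_space)
    next
      case 2
      have n: "norm w \<le> sqrt x \<longleftrightarrow> (norm w)\<^sup>2 \<le> x" for w :: complex
        using real_le_rsqrt real_sqrt_le_iff[of "(norm w)\<^sup>2" x] by auto
      have sub: "cball 0 (sqrt x) \<subseteq> (ball 0 1 :: complex set)"
      proof -
        have "sqrt x < 1" using 2 by simp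
        then show ?thesis by (auto intro: le_less_trans simp del: real_sqrt_lt_1_iff)
      qed
      have "(\<lambda>w::complex. (norm w)\<^sup>2) -` {x<..} \<inter> space dA = space dA - cball 0 (sqrt x)"
        using n by (auto simp: not_le[symmetric])
      moreover have "emeasure dA (cball 0 (sqrt x)) = ennreal x"
        using 2 sub emeasure_cball[of "sqrt x" "0::complex"]
        by (subst emeasure_dA(2)) (auto simp: unit_ball_vol_2 ennreal_mult[symmetric])
      moreover have "{0<..<1} \<inter> {x<..} = {x<..<1}" using 2 by auto
      ultimately show ?thesis
        using 2 sub emeasure_dA(1)[OF _ sub] emeasure_dA(1)[of "ball 0 1"]
        by (simp add: emeasure_distr D emeasure_Diff space_dA emeasure_dA_space[unfolded space_dA] ennreal_minus ennreal_1[symmetric] del: ennreal_1)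
    next
      case 3
      then have "\<not> x < (norm w)\<^sup>2" if "norm w < 1" for w :: complex
        using that abs_square_less_1[of "norm w"] by auto
      then have e: "(\<lambda>w::complex. (norm w)\<^sup>2) -` {x<..} \<inter> space dA = {}" by (auto simp: space_dA)
      have "{0<..<1} \<inter> {x<..} = {}" using 3 by auto
      then show ?thesis by (simp add: emeasure_distr D e)
    qed
  qed
  show ?thesis
    by (rule measure_eqI_lessThan) (auto simp: le[symmetric] emeasure_distr dA.emeasure_finite less_top[symmetric])
qed


lemma nn_integral_dA_norm_squared:
  fixes g :: "real \<Rightarrow> ennreal"
  assumes [measurable]: "g \<in> borel_measurable borel"
  shows "(\<integral>\<^sup>+w. g ((norm w)\<^sup>2) \<partial>dA) = (\<integral>\<^sup>+t. g t * indicator {0<..<1} t \<partial>lborel)"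
proof -
  have "(\<lambda>w. (norm w)\<^sup>2) \<in> borel_measurable dA"
    by (intro borel_measurable_dA) measurable
  then have "(\<integral>\<^sup>+w. g ((norm w)\<^sup>2) \<partial>dA) = (\<integral>\<^sup>+t. g t \<partial>distr dA borel (\<lambda>w. (norm w)\<^sup>2))"
    by (simp add: nn_integral_distr)
  also have "\<dots> = (\<integral>\<^sup>+t. g t * indicator {0<..<1} t \<partial>lborel)"
    unfolding distr_dA_norm_squared by (subst nn_integral_density) (auto simp: mult.commute)
  finally show ?thesis .
qed

section \<open>Binomial series on circles\<close>

text \<open>The coefficients of \<open>(1 - z)\<^bsup>-a\<^esup>\<close>.\<close>

definition binom_coeff :: "real \<Rightarrow> nat \<Rightarrow> real" where
  "binom_coeff a n = pochhammer a n / fact n"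

lemma binom_coeff_eq_gbinomial: "binom_coeff a n = (-1) ^ n * (- a gchoose n)"
  by (simp add: binom_coeff_def gbinomial_pochhammer flip: power_mult_distrib)

lemma binom_coeff_nonneg: "0 \<le> a \<Longrightarrow> 0 \<le> binom_coeff a n"
  by (simp add: binom_coeff_def pochhammer_prod prod_nonneg)

lemma binom_coeff_Suc: "binom_coeff a (Suc n) = binom_coeff a n * (real n + a) / (real n + 1)"
  by (simp add: binom_coeff_def pochhammer_Suc add_ac)

lemma sums_binom_coeff_complex:
  fixes z :: complex
  assumes "norm z < 1"
  shows "(\<lambda>n. of_real (binom_coeff a n) * z ^ n) sums ((1 - z) powr (- of_real a))"
proof -
  have "(of_real (- a) gchoose n :: complex) = of_real (- a gchoose n)" for n
    by (simp add: gbinomial_prod_rev)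
  then have "(- of_real a gchoose n) * (- z) ^ n = of_real (binom_coeff a n) * z ^ n" for n
    by (simp add: binom_coeff_eq_gbinomial power_minus[of z])
  then show ?thesis
    using gen_binomial_complex[of "- z" "- of_real a"] assms by simp
qed

lemma sums_binom_coeff_real:
  assumes "\<bar>x\<bar> < 1"
  shows "(\<lambda>n. binom_coeff a n * x ^ n) sums ((1 - x) powr (- a))"
  using gen_binomial_real[of "- x" "- a"] assms
  by (simp add: binom_coeff_eq_gbinomial power_minus[of x] mult_ac)

text \<open>Orthogonality of the characters of the circle. The interval is open to match the range
  of angles for which rotation invariance is available.\<close>

lemma has_integral_cis_multiple:
  "((\<lambda>\<theta>. cis (of_int k * \<theta>)) has_integral (if k = 0 then 2 * pi else 0)) {-pi<..<pi}"
proof (cases "k = 0")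
  case True
  then show ?thesis
    using has_integral_const_real[of "1::complex" "-pi" pi]
    by (simp add: has_integral_Icc_iff_Ioo[symmetric] scaleR_conv_of_real)
next
  case False
  define F where "F \<theta> = cis (of_int k * \<theta>) / (\<i> * of_int k)" for \<theta>
  have "((\<lambda>\<theta>. cis (of_int k * \<theta>)) has_integral F pi - F (-pi)) {-pi..pi}"
  proof (rule fundamental_theorem_of_calculus)
    fix x
    have "((\<lambda>z. exp (\<i> * of_int k * z) / (\<i> * of_int k)) has_field_derivative exp (\<i> * of_int k * of_real x)) (at (of_real x))"
      using False by (auto intro!: derivative_eq_intros)
    from has_vector_derivative_real_field[OF this]
    show "(F has_vector_derivative cis (of_int k * x)) (at x within {-pi..pi})"
      by (simp add: F_def[abs_def] cis_conv_exp mult.assoc)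
  qed simp
  moreover have "cis (of_int k * - pi) = cis (of_int k * pi)"
    by (simp add: complex_eq_iff mult.commute[of _ pi] sin_int_times_real)
  ultimately show ?thesis
    using False by (simp add: F_def has_integral_Icc_iff_Ioo)
qed

text \<open>Parseval's identity for a finite sum: in the expanded square only the diagonal terms
  survive integration.\<close>

lemma has_integral_trig_poly_norm_squared:
  fixes c :: "nat \<Rightarrow> complex"
  shows "((\<lambda>\<theta>. (norm (\<Sum>n<N. c n * cis \<theta> ^ n))\<^sup>2) has_integral (2 * pi * (\<Sum>n<N. (norm (c n))\<^sup>2))) {-pi<..<pi}"
proof -
  have "((\<lambda>\<theta>. \<Sum>m<N. \<Sum>n<N. c m * cnj (c n) * cis (of_int (int m - int n) * \<theta>)) has_integral
      (\<Sum>m<N. \<Sum>n<N. c m * cnj (c n) * (if int m - int n = 0 then 2 * pi else 0))) {-pi<..<pi}"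
    by (intro has_integral_sum finite_lessThan has_integral_mult_right has_integral_cis_multiple)
  moreover have "(\<Sum>m<N. \<Sum>n<N. c m * cnj (c n) * cis (of_int (int m - int n) * \<theta>)) =
      of_real ((norm (\<Sum>n<N. c n * cis \<theta> ^ n))\<^sup>2)" for \<theta>
  proof -
    have "cis (of_int (int m - int n) * \<theta>) = cis \<theta> ^ m * cnj (cis \<theta> ^ n)" for m n
    proof -
      have "cis \<theta> ^ m * cnj (cis \<theta> ^ n) = cis (real m * \<theta>) * cis (- (real n * \<theta>))"
        by (simp only: Complex.DeMoivre complex_cnj_power cis_cnj mult_minus_right)
      then show ?thesis by (simp add: cis_mult left_diff_distrib)
    qed
    then have "(\<Sum>m<N. \<Sum>n<N. c m * cnj (c n) * cis (of_int (int m - int n) * \<theta>)) =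
        (\<Sum>m<N. \<Sum>n<N. (c m * cis \<theta> ^ m) * cnj (c n * cis \<theta> ^ n))"
      by (intro sum.cong refl) (simp only: complex_cnj_mult mult_ac)
    then show ?thesis
      unfolding complex_norm_square cnj_sum sum_product .
  qed
  moreover have "(\<Sum>m<N. \<Sum>n<N. c m * cnj (c n) * (if int m - int n = 0 then 2 * pi else 0)) =
      of_real (2 * pi * (\<Sum>n<N. (norm (c n))\<^sup>2))"
  proof -
    have "(\<Sum>n<N. c m * cnj (c n) * (if int m - int n = 0 then 2 * pi else 0)) = of_real (2 * pi * (norm (c m))\<^sup>2)"
      if "m < N" for m
    proof -
      have "(\<Sum>n<N. c m * cnj (c n) * (if int m - int n = 0 then 2 * pi else 0)) =
          (\<Sum>n<N. if m = n then of_real (2 * pi) * (c n * cnj (c n)) else 0)"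
        by (intro sum.cong refl) auto
      also have "\<dots> = of_real (2 * pi) * (c m * cnj (c m))"
        using that by (simp only: sum.delta' finite_lessThan lessThan_iff if_True)
      finally show ?thesis by (simp only: of_real_mult complex_norm_square)
    qed
    then show ?thesis by (simp add: sum_distrib_left)
  qed
  ultimately have "((\<lambda>\<theta>. complex_of_real ((norm (\<Sum>n<N. c n * cis \<theta> ^ n))\<^sup>2)) has_integral
      of_real (2 * pi * (\<Sum>n<N. (norm (c n))\<^sup>2))) {-pi<..<pi}"
    by simp
  from has_integral_Re[OF this] show ?thesis by simp
qed

text \<open>The integrand is the squared modulus of (1 - v)^(-a) at v =
  \<open>cis \<theta> * \<rho>\<close>. Parseval applies to the partial sums of its binomial series,
  and dominated convergence passes to the limit.\<close>

lemma nn_integral_circle_norm_powr: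
  assumes a: "0 \<le> a" and \<rho>: "norm \<rho> < 1"
  shows "(\<integral>\<^sup>+\<theta>. ennreal (norm (1 - cis \<theta> * \<rho>) powr (- 2 * a)) * indicator {-pi<..<pi} \<theta> \<partial>lborel)
    = ennreal (2 * pi) * (\<Sum>n. ennreal ((binom_coeff a n)\<^sup>2 * norm \<rho> ^ (2 * n)))"
proof -
  define c where "c n = of_real (binom_coeff a n) * \<rho> ^ n" for n
  define h where "h N \<theta> = (\<Sum>n<N. c n * cis \<theta> ^ n)" for N \<theta>
  \<comment> \<open>The coefficients are nonnegative, so the series of absolute values is again a
    binomial series, now at |\<rho>|; its sum bounds all partial sums uniformly in \<theta>.\<close>
  define M where "M = (1 - norm \<rho>) powr (- a)"
  have nc: "norm (c n) = binom_coeff a n * norm \<rho> ^ n" for n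
    using a by (simp add: c_def norm_mult norm_power binom_coeff_nonneg)
  have cs: "(\<lambda>n. norm (c n)) sums M"
    unfolding nc M_def using \<rho> by (intro sums_binom_coeff_real) simp
  have hM: "norm (h N \<theta>) \<le> M" for N \<theta>
  proof -
    have "norm (h N \<theta>) \<le> (\<Sum>n<N. norm (c n))"
      unfolding h_def by (rule sum_norm_le) (simp add: norm_mult norm_power)
    also have "\<dots> \<le> M"
      using cs by (metis norm_ge_zero sum_le_suminf sums_iff finite_lessThan)
    finally show ?thesis .
  qed
  have hlim: "(\<lambda>N. (norm (h N \<theta>))\<^sup>2) \<longlonglongrightarrow> norm (1 - cis \<theta> * \<rho>) powr (- 2 * a)" for \<theta>
  proof -
    have n: "norm (cis \<theta> * \<rho>) < 1" using \<rho> by (simp add: norm_mult)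
    have "(\<lambda>N. h N \<theta>) \<longlonglongrightarrow> (1 - cis \<theta> * \<rho>) powr (- of_real a)"
      using sums_binom_coeff_complex[OF n, of a]
      by (simp add: sums_def h_def c_def power_mult_distrib mult_ac)
    then have "(\<lambda>N. (norm (h N \<theta>))\<^sup>2) \<longlonglongrightarrow> (norm ((1 - cis \<theta> * \<rho>) powr (- of_real a)))\<^sup>2"
      by (intro tendsto_intros)
    also have "norm ((1 - cis \<theta> * \<rho>) powr (- of_real a)) = norm (1 - cis \<theta> * \<rho>) powr (- a)"
      using norm_powr_real_powr'[of "of_real (-a)" "1 - cis \<theta> * \<rho>"] by simp
    also have "(\<dots>)\<^sup>2 = norm (1 - cis \<theta> * \<rho>) powr (- 2 * a)"
      by (simp add: power2_eq_square flip: powr_add)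
    finally show ?thesis .
  qed
  have h_meas [measurable]: "h N \<in> borel_measurable borel" for N
    unfolding h_def[abs_def] cis_conv_exp by measurable
  have "(\<lambda>N. \<integral>\<^sup>+\<theta>. ennreal ((norm (h N \<theta>))\<^sup>2) * indicator {-pi<..<pi} \<theta> \<partial>lborel) \<longlonglongrightarrow>
     (\<integral>\<^sup>+\<theta>. ennreal (norm (1 - cis \<theta> * \<rho>) powr (- 2 * a)) * indicator {-pi<..<pi} \<theta> \<partial>lborel)"
  proof (rule nn_integral_dominated_convergence[where w = "\<lambda>\<theta>. ennreal (M\<^sup>2) * indicator {-pi<..<pi} \<theta>"])
    show "(\<lambda>\<theta>. ennreal (norm (1 - cis \<theta> * \<rho>) powr (- 2 * a)) * indicator {-pi<..<pi} \<theta>) \<in> borel_measurable lborel"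
      unfolding cis_conv_exp by measurable
    show "AE x in lborel. ennreal ((cmod (h N x))\<^sup>2) * indicator {- pi<..<pi} x \<le> ennreal (M\<^sup>2) * indicator {- pi<..<pi} x" for N
      using hM by (intro AE_I2 mult_right_mono ennreal_leI power_mono) auto
    show "(\<integral>\<^sup>+ x. ennreal (M\<^sup>2) * indicator {- pi<..<pi} x \<partial>lborel) < \<infinity>"
      by (subst nn_integral_cmult_indicator) (auto simp: ennreal_mult_less_top)
    show "AE x in lborel. (\<lambda>i. ennreal ((cmod (h i x))\<^sup>2) * indicator {- pi<..<pi} x) \<longlonglongrightarrow> ennreal (cmod (1 - cis x * \<rho>) powr (- 2 * a)) * indicator {- pi<..<pi} x"
      using hlim by (intro AE_I2) (auto simp: indicator_def intro!: tendsto_ennrealI)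
  qed measurable
  moreover have "(\<integral>\<^sup>+\<theta>. ennreal ((norm (h N \<theta>))\<^sup>2) * indicator {-pi<..<pi} \<theta> \<partial>lborel) =
     ennreal (2 * pi * (\<Sum>n<N. (norm (c n))\<^sup>2))" for N
    unfolding h_def by (intro nn_integral_has_integral_lebesgue' has_integral_trig_poly_norm_squared) simp
  moreover have "(\<lambda>N. ennreal (2 * pi * (\<Sum>n<N. (norm (c n))\<^sup>2))) \<longlonglongrightarrow> ennreal (2 * pi) * (\<Sum>n. ennreal ((norm (c n))\<^sup>2))"
  proof -
    have "(\<lambda>N. ennreal (2 * pi) * (\<Sum>n<N. ennreal ((norm (c n))\<^sup>2))) \<longlonglongrightarrow> ennreal (2 * pi) * (\<Sum>n. ennreal ((norm (c n))\<^sup>2))"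
      by (intro ennreal_tendsto_cmult summable_LIMSEQ) auto
    then show ?thesis
      by (simp add: ennreal_mult' sum_nonneg)
  qed
  ultimately have "(\<integral>\<^sup>+\<theta>. ennreal (norm (1 - cis \<theta> * \<rho>) powr (- 2 * a)) * indicator {-pi<..<pi} \<theta> \<partial>lborel)
      = ennreal (2 * pi) * (\<Sum>n. ennreal ((norm (c n))\<^sup>2))"
    using LIMSEQ_unique by auto
  moreover have "(norm (c n))\<^sup>2 = (binom_coeff a n)\<^sup>2 * norm \<rho> ^ (2 * n)" for n
    by (simp only: nc power_mult_distrib power_mult[symmetric] mult.commute[of 2 n])
  ultimately show ?thesis by simp
qed

text \<open>Rotating w does not change the integral, so it equals its own average over all angles;
  Tonelli moves this average inside, where the circle formula applies. \<open>g\<close> carries a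
  radial weight and a cut-off, and \<open>u\<close> may turn with w (as c w and w / z do) or against
  it (as z / w does). Where \<open>g\<close> vanishes the series need not converge.\<close>

lemma nn_integral_dA_radial_times_norm_powr:
  fixes g :: "complex \<Rightarrow> ennreal" and u :: "complex \<Rightarrow> complex"
  assumes a: "0 \<le> a"
    and gm [measurable]: "g \<in> borel_measurable borel" and um [measurable]: "u \<in> borel_measurable borel"
    and g_rot: "\<And>\<theta> w. g (cis \<theta> * w) = g w"
    and u_rot: "(\<forall>\<theta> w. u (cis \<theta> * w) = cis \<theta> * u w) \<or> (\<forall>\<theta> w. u (cis \<theta> * w) = cis (- \<theta>) * u w)"
    and u1: "\<And>w. norm w < 1 \<Longrightarrow> g w = 0 \<or> norm (u w) < 1"
  shows "(\<integral>\<^sup>+w. g w * ennreal (norm (1 - u w) powr (- 2 * a)) \<partial>dA)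
    = (\<Sum>n. ennreal ((binom_coeff a n)\<^sup>2) * (\<integral>\<^sup>+w. g w * ennreal (norm (u w) ^ (2 * n)) \<partial>dA))"
proof -
  interpret P: pair_sigma_finite lborel dA ..
  let ?I = "indicator {-pi<..<pi} :: real \<Rightarrow> ennreal"
  define F where "F w = g w * ennreal (norm (1 - u w) powr (- 2 * a))" for w
  have [measurable]: "F \<in> borel_measurable borel"
    unfolding F_def[abs_def] by measurable
  have idm [measurable]: "(\<lambda>w. w) \<in> dA \<rightarrow>\<^sub>M borel"
    by (rule borel_measurable_dA) simp
  have [measurable]: "cis \<in> borel_measurable borel"
    unfolding cis_conv_exp[abs_def] by measurable
  have "(\<lambda>p. cis (fst p) * snd p) \<in> lborel \<Otimes>\<^sub>M dA \<rightarrow>\<^sub>M borel"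
    using measurable_compose[OF measurable_snd idm] by measurable
  then have Fm: "(\<lambda>(\<theta>, w). F (cis \<theta> * w) * ?I \<theta>) \<in> borel_measurable (lborel \<Otimes>\<^sub>M dA)"
    by (simp add: case_prod_beta')
  have circ: "(\<integral>\<^sup>+\<theta>. F (cis \<theta> * w) * ?I \<theta> \<partial>lborel) =
      ennreal (2 * pi) * (\<Sum>n. ennreal ((binom_coeff a n)\<^sup>2) * (g w * ennreal (norm (u w) ^ (2 * n))))"
    if w: "norm w < 1" for w
  proof (cases "g w = 0")
    case True
    then show ?thesis by (simp add: F_def g_rot)
  next
    case False
    \<comment> \<open>Conjugation preserves the modulus of 1 - u and reverses the sense of rotation,
      which reduces the second case to the first.\<close>
    define v where "v = (if \<forall>\<theta> w. u (cis \<theta> * w) = cis \<theta> * u w then u w else cnj (u w))"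
    have nv: "norm v = norm (u w)" by (simp add: v_def)
    have v1: "norm v < 1" using u1[OF w] False nv by simp
    have "norm (1 - u (cis \<theta> * w)) = norm (1 - cis \<theta> * v)" for \<theta>
    proof (cases "\<forall>\<theta> w. u (cis \<theta> * w) = cis \<theta> * u w")
      case False
      then have "norm (1 - u (cis \<theta> * w)) = norm (1 - cis (- \<theta>) * u w)" using u_rot by metis
      also have "\<dots> = norm (cnj (1 - cis (- \<theta>) * u w))" by (rule complex_mod_cnj[symmetric])
      also have "v = cnj (u w)" using False unfolding v_def by (rule if_not_P)
      then have "norm (cnj (1 - cis (- \<theta>) * u w)) = norm (1 - cis \<theta> * v)" by (simp add: cis_cnj)
      finally show ?thesis .
    qed (simp add: v_def)
    then have "(\<integral>\<^sup>+\<theta>. F (cis \<theta> * w) * ?I \<theta> \<partial>lborel) =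
        (\<integral>\<^sup>+\<theta>. g w * (ennreal (norm (1 - cis \<theta> * v) powr (- 2 * a)) * ?I \<theta>) \<partial>lborel)"
      by (simp add: F_def g_rot mult.assoc)
    also have "\<dots> = g w * (\<integral>\<^sup>+\<theta>. (ennreal (norm (1 - cis \<theta> * v) powr (- 2 * a)) * ?I \<theta>) \<partial>lborel)"
      by (intro nn_integral_cmult) measurable
    also have "\<dots> = g w * (ennreal (2 * pi) * (\<Sum>n. ennreal ((binom_coeff a n)\<^sup>2 * norm (u w) ^ (2 * n))))"
      by (simp only: nn_integral_circle_norm_powr[OF a v1] nv)
    also have "\<dots> = ennreal (2 * pi) * (\<Sum>n. g w * ennreal ((binom_coeff a n)\<^sup>2 * norm (u w) ^ (2 * n)))"
      by (simp only: ennreal_suminf_cmult mult.left_commute)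
    also have "(\<lambda>n. g w * ennreal ((binom_coeff a n)\<^sup>2 * norm (u w) ^ (2 * n))) =
        (\<lambda>n. ennreal ((binom_coeff a n)\<^sup>2) * (g w * ennreal (norm (u w) ^ (2 * n))))"
      by (simp add: ennreal_mult mult.left_commute)
    finally show ?thesis .
  qed
  have pos: "ennreal (2 * pi) \<noteq> 0" "ennreal (2 * pi) \<noteq> top" by auto
  have "ennreal (2 * pi) * (\<integral>\<^sup>+w. F w \<partial>dA) = (\<integral>\<^sup>+\<theta>. (\<integral>\<^sup>+w. F w \<partial>dA) * ?I \<theta> \<partial>lborel)"
    by (simp add: nn_integral_cmult_indicator mult.commute)
  also have "\<dots> = (\<integral>\<^sup>+\<theta>. (\<integral>\<^sup>+w. F (cis \<theta> * w) * ?I \<theta> \<partial>dA) \<partial>lborel)"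
    by (intro nn_integral_cong) (auto simp: indicator_def nn_integral_dA_rotate)
  also have "\<dots> = (\<integral>\<^sup>+w. (\<integral>\<^sup>+\<theta>. F (cis \<theta> * w) * ?I \<theta> \<partial>lborel) \<partial>dA)"
    using P.Fubini'[OF Fm] by simp
  also have "\<dots> = (\<integral>\<^sup>+w. ennreal (2 * pi) * (\<Sum>n. ennreal ((binom_coeff a n)\<^sup>2) * (g w * ennreal (norm (u w) ^ (2 * n)))) \<partial>dA)"
    by (intro nn_integral_cong circ) (simp add: space_dA)
  also have "\<dots> = ennreal (2 * pi) * (\<integral>\<^sup>+w. (\<Sum>n. ennreal ((binom_coeff a n)\<^sup>2) * (g w * ennreal (norm (u w) ^ (2 * n)))) \<partial>dA)"
    by (intro nn_integral_cmult borel_measurable_dA) measurable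
  also have "(\<integral>\<^sup>+w. (\<Sum>n. ennreal ((binom_coeff a n)\<^sup>2) * (g w * ennreal (norm (u w) ^ (2 * n)))) \<partial>dA)
      = (\<Sum>n. \<integral>\<^sup>+w. ennreal ((binom_coeff a n)\<^sup>2) * (g w * ennreal (norm (u w) ^ (2 * n))) \<partial>dA)"
    by (intro nn_integral_suminf borel_measurable_dA) measurable
  also have "\<dots> = (\<Sum>n. ennreal ((binom_coeff a n)\<^sup>2) * (\<integral>\<^sup>+w. g w * ennreal (norm (u w) ^ (2 * n)) \<partial>dA))"
    by (intro suminf_cong nn_integral_cmult borel_measurable_dA) measurable
  finally show ?thesis
    using pos by (simp add: ennreal_mult_cancel_left F_def)
qed

section \<open>The hypergeometric sum\<close>

text \<open>The coefficients behave like n^(a-1) / Gamma(a), and a < 1.\<close>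

lemma binom_coeff_tendsto_0:
  assumes "0 < a" "a < 1"
  shows "binom_coeff a \<longlonglongrightarrow> 0"
proof -
  have 1: "(\<lambda>n. (- a gchoose n) / ((-1) ^ n / exp ((1 - a) * ln (real n)))) \<longlonglongrightarrow> inverse (Gamma a)"
    using gbinomial_asymptotic[of "- a"] by simp
  have 2: "(\<lambda>n. real n powr (- (1 - a))) \<longlonglongrightarrow> 0"
    using assms by (intro tendsto_neg_powr filterlim_real_sequentially) simp
  have "(\<lambda>n. (- a gchoose n) / ((-1) ^ n / exp ((1 - a) * ln (real n))) * real n powr (- (1 - a))) \<longlonglongrightarrow> 0"
    using tendsto_mult[OF 1 2] by simp
  then show ?thesis
  proof (rule Lim_transform_eventually)
    show "\<forall>\<^sub>F n in sequentially. (- a gchoose n) / ((-1) ^ n / exp ((1 - a) * ln (real n))) * real n powr (- (1 - a)) = binom_coeff a n"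
    proof (rule eventually_mono[OF eventually_gt_at_top[of 0]])
      fix n :: nat assume "0 < n"
      then have "real n powr (- (1 - a)) = inverse (exp ((1 - a) * ln (real n)))"
        by (simp add: powr_def exp_minus[symmetric] algebra_simps)
      moreover have "x / (-1) ^ n = (-1) ^ n * x" for x :: real
        by (cases "even n") auto
      ultimately show "(- a gchoose n) / ((-1) ^ n / exp ((1 - a) * ln (real n))) * real n powr (- (1 - a)) = binom_coeff a n"
        by (simp add: binom_coeff_eq_gbinomial)
    qed
  qed
qed

text \<open>Bernoulli's inequality, obtained from the weighted means of y = x^t and 1 with weights s
  / t and 1 - s / t.\<close>

lemma one_minus_powr_ratio_le:
  fixes x s t :: real
  assumes "0 < x" "x < 1" "0 < s" "s \<le> t"
  shows "s / t * (1 - x powr t) \<le> 1 - x powr s"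
proof -
  have "(x powr t) powr (s / t) * 1 powr (1 - s / t) \<le> s / t * x powr t + (1 - s / t) * 1"
    using assms by (intro Youngs_inequality_0) auto
  then show ?thesis using assms by (simp add: powr_powr algebra_simps)
qed

text \<open>The value at 1 of the hypergeometric series with parameters \<open>a, a; 2\<close>.\<close>

definition hyper_sum :: "real \<Rightarrow> real" where
  "hyper_sum a = (\<Sum>n. (binom_coeff a n)\<^sup>2 / (real n + 1))"

context
  fixes a :: real
  assumes a: "0 < a" "a < 1"
begin

private lemma nz: "real n + a - 1 \<noteq> 0" "1 - a - real n \<noteq> 0"
proof -
  show "real n + a - 1 \<noteq> 0" using a by (cases n) auto
  then show "1 - a - real n \<noteq> 0" by linarith
qed

text \<open>This sum is the coefficient of x^(1-a) in U(z): the part |w| < |z| contributes the first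
  fraction and the part |w| > |z| the second.\<close>

lemma sums_binom_coeff_telescope:
  "(\<lambda>n. (binom_coeff a n)\<^sup>2 * (1 / (real n + 1) - 1 / (1 - a - real n))) sums 0"
proof -
  \<comment> \<open>The factor n gives \<open>T 0 = 0\<close>. The ratio of consecutive coefficients
    makes \<open>T (Suc n)\<close> a rational multiple of the n-th squared coefficient, and partial
    fractions turn the difference into the summand. Since the coefficients tend to 0, so does
    T.\<close>
  define T where "T n = (binom_coeff a n)\<^sup>2 * (real n / (real n + a - 1)) / (a - 1)" for n
  have "(\<lambda>n. real n / (real n + a - 1)) \<longlonglongrightarrow> 1"
    by real_asymp
  then have "T \<longlonglongrightarrow> 0\<^sup>2 * 1 / (a - 1)"
    unfolding T_def[abs_def] using a by (intro tendsto_intros binom_coeff_tendsto_0) auto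
  then have "(\<lambda>n. T (Suc n) - T n) sums (0 - T 0)"
    by (intro telescope_sums) simp
  moreover have "T (Suc n) - T n = (binom_coeff a n)\<^sup>2 * (1 / (real n + 1) - 1 / (1 - a - real n))" for n
  proof -
    have p: "real n + a \<noteq> 0" "1 + real n \<noteq> 0" "a - 1 \<noteq> 0" "real n + 1 \<noteq> 0" using a by auto
    have "T (Suc n) = (binom_coeff a n)\<^sup>2 * ((real n + a) / (real n + 1)) / (a - 1)"
    proof -
      have e: "real (Suc n) / (real (Suc n) + a - 1) = (real n + 1) / (real n + a)" by (simp add: add.commute)
      have "(b * u / v)\<^sup>2 * (v / u) / c = b\<^sup>2 * (u / v) / c" if "u \<noteq> 0" "v \<noteq> 0" for b u v c :: real
        using that by (simp add: power2_eq_square)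
      from this[OF p(1,4)] show ?thesis unfolding T_def binom_coeff_Suc e by blast
    qed
    then have "T (Suc n) - T n = (binom_coeff a n)\<^sup>2 * ((real n + a) / (real n + 1) - real n / (real n + a - 1)) / (a - 1)"
      by (simp add: T_def diff_divide_distrib right_diff_distrib)
    moreover have "((real n + a) / (real n + 1) - real n / (real n + a - 1)) / (a - 1) = 1 / (real n + 1) - 1 / (1 - a - real n)"
    proof -
      have "1 / (1 - a - real n) = - (1 / (real n + a - 1))"
        by (metis minus_diff_eq minus_divide_right diff_diff_eq2 diff_diff_eq add.commute)
      moreover have "(real n + a) / (real n + 1) - real n / (real n + a - 1) = (a - 1) * (1 / (real n + 1) + 1 / (real n + a - 1))"
        using p nz(1)[of n] by (simp add: divide_simps) (simp add: algebra_simps)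
      ultimately show ?thesis using p by simp
    qed
    ultimately show ?thesis by (simp only: times_divide_eq_right[symmetric])
  qed
  moreover have "T 0 = 0" by (simp add: T_def)
  ultimately show ?thesis by simp
qed

lemma sums_hyper_sum:
  "(\<lambda>n. (binom_coeff a n)\<^sup>2 / (real n + 1)) sums hyper_sum a"
proof -
  have "summable (\<lambda>n. (binom_coeff a n)\<^sup>2 / (real n + 1))"
  \<comment> \<open>From n = 1 on, 1 / (1 - a - n) is negative, so the telescoping series dominates
    this one.\<close>
  proof (rule summable_comparison_test'[OF sums_summable[OF sums_binom_coeff_telescope]])
    fix n :: nat assume "1 \<le> n"
    then have "1 / (1 - a - real n) \<le> 0" using a by (simp add: divide_le_0_iff)
    then have "(binom_coeff a n)\<^sup>2 * (1 / (real n + 1)) \<le> (binom_coeff a n)\<^sup>2 * (1 / (real n + 1) - 1 / (1 - a - real n))"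
      by (intro mult_left_mono) auto
    then show "norm ((binom_coeff a n)\<^sup>2 / (real n + 1)) \<le> (binom_coeff a n)\<^sup>2 * (1 / (real n + 1) - 1 / (1 - a - real n))"
      by simp
  qed
  then show ?thesis unfolding hyper_sum_def by (rule summable_sums)
qed

text \<open>At x = 1 the series for U(z) and for U(1 / cnj z) have the same value, because their
  difference is the telescoping sum.\<close>

lemma sums_hyper_sum':
  "(\<lambda>n. (binom_coeff a n)\<^sup>2 / (1 - a - real n)) sums hyper_sum a"
proof -
  have "(binom_coeff a n)\<^sup>2 / (real n + 1) - (binom_coeff a n)\<^sup>2 * (1 / (real n + 1) - 1 / (1 - a - real n)) =
      (binom_coeff a n)\<^sup>2 / (1 - a - real n)" for n
    unfolding right_diff_distrib by simp
  then show ?thesis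
    using sums_diff[OF sums_hyper_sum sums_binom_coeff_telescope] by simp
qed

text \<open>With x = |z|^2, A is U(z), kept as the contributions of |w| < |z| and |w| > |z|, and B
  is U(1 / cnj z). After cancellation of x^(1-a), each is compared with \<open>hyper_sum a\<close>,
  its value at x = 1.\<close>

lemma potential_sums:
  assumes x: "0 < x" "x < 1"
  shows "\<exists>A B. (\<lambda>n. (binom_coeff a n)\<^sup>2 * (x powr (1 - a) / (real n + 1) + (x ^ n - x powr (1 - a)) / (1 - a - real n))) sums A
    \<and> (\<lambda>n. (binom_coeff a n)\<^sup>2 * (x powr a * x ^ n / (real n + 1))) sums B \<and> A + B \<le> 2 * hyper_sum a"
proof -
  define d where "d n = (binom_coeff a n)\<^sup>2" for n
  define f where "f n = d n / (1 - a - real n)" for n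
  have d0: "0 \<le> d n" for n by (simp add: d_def)
  have dS: "(\<lambda>n. d n / (real n + 1)) sums hyper_sum a" and fS: "f sums hyper_sum a"
    using sums_hyper_sum sums_hyper_sum' by (simp_all add: d_def f_def[abs_def])
  have x1: "0 \<le> x ^ n" "x ^ n \<le> 1" for n using x by (auto intro: power_le_one)
  \<comment> \<open>The shift of index brings the term of U(z) to the common factor
    \<open>d n / (n + 1)\<close> of the n-th term of U(1 / cnj z). What is left over is the ratio of
    the exponents n + a and n + 1.\<close>
  have fneg: "f (Suc n) = - (d n / (real n + 1)) * ((real n + a) / (real n + 1))" for n
  proof -
    have p: "real n + a \<noteq> 0" "1 + real n \<noteq> 0" using a by auto
    have e: "1 - a - real (Suc n) = - (real n + a)" by simp
    have "f (Suc n) = - (d n * (real n + a)\<^sup>2 / (real n + 1)\<^sup>2 / (real n + a))"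
      unfolding f_def d_def binom_coeff_Suc power_mult_distrib power_divide e by (simp only: minus_divide_right)
    then show ?thesis using p by (simp add: power2_eq_square)
  qed
  have fneg0: "f (Suc n) \<le> 0" for n unfolding fneg using d0[of n] a by simp
  have sumA: "summable (\<lambda>n. f (Suc n) * x ^ Suc n)"
  proof (rule summable_comparison_test'[of "\<lambda>n. - f (Suc n)" 0])
    show "summable (\<lambda>n. - f (Suc n))"
      using fS by (intro summable_minus) (simp add: summable_Suc_iff sums_summable)
    show "norm (f (Suc n) * x ^ Suc n) \<le> - f (Suc n)" for n
      using fneg0[of n] x1[of "Suc n"] mult_left_mono_neg[OF x1(2)[of "Suc n"] fneg0[of n]]
      by (simp add: abs_mult del: power_Suc)
  qed
  define A' where "A' = (\<Sum>n. f (Suc n) * x ^ Suc n)"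
  have A': "(\<lambda>n. f (Suc n) * x ^ Suc n) sums A'"
    unfolding A'_def using sumA by (rule summable_sums)
  then have A1: "(\<lambda>n. f n * x ^ n) sums (A' + f 0)"
    using sums_Suc_iff[of "\<lambda>n. f n * x ^ n"] by simp
  \<comment> \<open>A multiple of the telescoping sum, hence zero in total, is added to recover the
    form in which the two regions of integration deliver U(z).\<close>
  have "(\<lambda>n. x powr (1 - a) * (d n * (1 / (real n + 1) - 1 / (1 - a - real n))) + f n * x ^ n) sums (x powr (1 - a) * 0 + (A' + f 0))"
    unfolding d_def by (intro sums_add sums_mult sums_binom_coeff_telescope A1[unfolded d_def])
  also have "(\<lambda>n. x powr (1 - a) * (d n * (1 / (real n + 1) - 1 / (1 - a - real n))) + f n * x ^ n) =
     (\<lambda>n. d n * (x powr (1 - a) / (real n + 1) + (x ^ n - x powr (1 - a)) / (1 - a - real n)))"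
    by (rule ext) (simp add: f_def algebra_simps diff_divide_distrib)
  finally have A: "(\<lambda>n. d n * (x powr (1 - a) / (real n + 1) + (x ^ n - x powr (1 - a)) / (1 - a - real n))) sums (A' + f 0)"
    by simp
  have xa: "x powr a * x ^ n = x powr (real n + a)" for n
    using x by (simp add: powr_add powr_realpow)
  have xa1: "0 \<le> x powr (real n + a)" "x powr (real n + a) \<le> 1" for n
    using x a by (auto intro!: powr_le1)
  have "summable (\<lambda>n. d n / (real n + 1) * x powr (real n + a))"
  proof (rule summable_comparison_test'[OF sums_summable[OF dS]])
    show "norm (d n / (real n + 1) * x powr (real n + a)) \<le> d n / (real n + 1)" for n
    proof -
      have dn: "0 \<le> d n / (real n + 1)" using d0[of n] by simp
      have "0 \<le> d n / (real n + 1) * x powr (real n + a)"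
        by (intro mult_nonneg_nonneg dn xa1)
      then show ?thesis
        using mult_left_mono[OF xa1(2) dn] by (simp only: real_norm_def abs_of_nonneg mult_1_right)
    qed
  qed
  then obtain B where B: "(\<lambda>n. d n / (real n + 1) * x powr (real n + a)) sums B"
    by (auto simp: summable_def)
  have "(\<lambda>n. f (Suc n)) sums (hyper_sum a - f 0)"
    using fS by (simp add: sums_Suc_iff)
  \<comment> \<open>The term f 0 is constant in x and drops out of the comparison with x = 1, so the
    pairing has no leftover term.\<close>
  then have h1: "(\<lambda>n. (f (Suc n) - f (Suc n) * x ^ Suc n) + (d n / (real n + 1) - d n / (real n + 1) * x powr (real n + a)))
     sums ((hyper_sum a - f 0 - A') + (hyper_sum a - B))"
    by (intro sums_add sums_diff A' B dS)
  have h2: "0 \<le> (f (Suc n) - f (Suc n) * x ^ Suc n) + (d n / (real n + 1) - d n / (real n + 1) * x powr (real n + a))" for n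
  proof -
    have "(real n + a) / (real n + 1) * (1 - x powr (real n + 1)) \<le> 1 - x powr (real n + a)"
      using x a by (intro one_minus_powr_ratio_le) auto
    moreover have "x powr (real n + 1) = x ^ Suc n"
      using x by (simp add: powr_add powr_realpow)
    ultimately have "d n / (real n + 1) * ((real n + a) / (real n + 1) * (1 - x ^ Suc n)) \<le> d n / (real n + 1) * (1 - x powr (real n + a))"
      using d0[of n] by (intro mult_left_mono) auto
    moreover have "(f (Suc n) - f (Suc n) * x ^ Suc n) = - (d n / (real n + 1) * ((real n + a) / (real n + 1) * (1 - x ^ Suc n)))"
    proof -
      have "- D * R - - D * R * y = - (D * (R * (1 - y)))" for D R y :: real
        by (simp add: algebra_simps)
      then show ?thesis unfolding fneg .
    qed
    ultimately show ?thesis by (simp add: right_diff_distrib)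
  qed
  have "0 \<le> (hyper_sum a - f 0 - A') + (hyper_sum a - B)"
    by (rule sums_le[OF h2 sums_zero h1])
  then have "(A' + f 0) + B \<le> 2 * hyper_sum a" by simp
  moreover have "(\<lambda>n. d n * (x powr a * x ^ n / (real n + 1))) sums B"
    using B unfolding xa by simp
  ultimately show ?thesis using A unfolding d_def by blast
qed

text \<open>In the integral of t^(a-1) (1-t)^(1-2a), a Beta value, split off (1-t)^(-a) and expand
  it. Each term is again a Beta integral, equal to Gamma(a) Gamma(2-a) times a term of the
  sum.\<close>

lemma hyper_sum_eq_Gamma: "hyper_sum a = Gamma (2 - 2 * a) / (Gamma (2 - a))\<^sup>2"
proof -
  \<comment> \<open>The exponents are left in the shape b - 1 of the Beta integrand; the factor
    (1-t)^(1-a) is what remains after (1-t)^(-a) has been split off.\<close>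
  define k where "k n t = binom_coeff a n * (t powr (a + real n - 1) * (1 - t) powr (2 - a - 1))" for n t
  have G: "Gamma a > 0" "Gamma (2 - a) > 0" using a by auto
  have b0: "0 \<le> binom_coeff a n" for n using a by (simp add: binom_coeff_nonneg)
  have k0: "0 \<le> k n t" for n t unfolding k_def using b0 by simp
  have [measurable]: "k n \<in> borel_measurable borel" for n
    unfolding k_def[abs_def] by measurable
  have sk: "(\<lambda>n. k n t) sums (t powr (a - 1) * (1 - t) powr (2 - 2 * a - 1))" if "0 < t" "t < 1" for t
  proof -
    have "(\<lambda>n. (t powr (a - 1) * (1 - t) powr (2 - a - 1)) * (binom_coeff a n * t ^ n)) sums
       ((t powr (a - 1) * (1 - t) powr (2 - a - 1)) * (1 - t) powr (- a))"
      using that by (intro sums_mult sums_binom_coeff_real) auto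
    moreover have "(t powr (a - 1) * (1 - t) powr (2 - a - 1)) * (binom_coeff a n * t ^ n) = k n t" for n
      using that by (simp add: k_def powr_diff powr_add powr_realpow)
    moreover have "(1 - t) powr (2 - a - 1) * (1 - t) powr (- a) = (1 - t) powr (2 - 2 * a - 1)"
      unfolding powr_add[symmetric] by simp
    ultimately show ?thesis by (simp add: mult.assoc)
  qed
  have "ennreal (Beta a (2 - 2 * a)) = (\<integral>\<^sup>+t. ennreal (t powr (a - 1) * (1 - t) powr (2 - 2 * a - 1)) * indicator {0<..<1} t \<partial>lborel)"
    using a has_integral_Beta_real[of a "2 - 2 * a"]
    by (intro nn_integral_has_integral_lebesgue'[symmetric]) (auto simp: has_integral_Icc_iff_Ioo)
  also have "\<dots> = (\<integral>\<^sup>+t. (\<Sum>n. ennreal (k n t) * indicator {0<..<1} t) \<partial>lborel)"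
  proof (intro nn_integral_cong)
    fix t :: real
    show "ennreal (t powr (a - 1) * (1 - t) powr (2 - 2 * a - 1)) * indicator {0<..<1} t = (\<Sum>n. ennreal (k n t) * indicator {0<..<1} t)"
    proof (cases "0 < t \<and> t < 1")
      case True
      then have "(\<Sum>n. ennreal (k n t)) = ennreal (t powr (a - 1) * (1 - t) powr (2 - 2 * a - 1))"
        by (intro suminf_ennreal_eq k0 sk) auto
      with True show ?thesis by simp
    qed auto
  qed
  also have "\<dots> = (\<Sum>n. \<integral>\<^sup>+t. ennreal (k n t) * indicator {0<..<1} t \<partial>lborel)"
    by (rule nn_integral_suminf) measurable
  also have "\<dots> = (\<Sum>n. ennreal (binom_coeff a n * Beta (a + real n) (2 - a)))"
  proof (intro suminf_cong nn_integral_has_integral_lebesgue' k0)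
    show "(k n has_integral binom_coeff a n * Beta (a + real n) (2 - a)) {0<..<1}" for n
      unfolding k_def has_integral_Icc_iff_Ioo[symmetric] using a
      by (intro has_integral_mult_right has_integral_Beta_real) auto
  qed
  also have "(\<lambda>n. binom_coeff a n * Beta (a + real n) (2 - a)) = (\<lambda>n. Gamma a * Gamma (2 - a) * ((binom_coeff a n)\<^sup>2 / (real n + 1)))"
  proof
    fix n
    have "a \<notin> \<int>\<^sub>\<le>\<^sub>0" using a by (auto simp: nonpos_Ints_def)
    then have "pochhammer a n = Gamma (a + real n) / Gamma a" by (rule pochhammer_Gamma)
    then have "Gamma (a + real n) = pochhammer a n * Gamma a" using G by simp
    moreover have "Gamma (real n + 2) = fact (Suc n)"
      using Gamma_fact[of "Suc n", where ?'a = real] by (simp add: add_ac)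
    moreover have "a + real n + (2 - a) = real n + 2" by simp
    ultimately have "Beta (a + real n) (2 - a) = pochhammer a n * Gamma a * Gamma (2 - a) / fact (Suc n)"
      by (simp only: Beta_altdef divide_inverse rGamma_inverse_Gamma mult_ac)
    then show "binom_coeff a n * Beta (a + real n) (2 - a) = Gamma a * Gamma (2 - a) * ((binom_coeff a n)\<^sup>2 / (real n + 1))"
      by (simp add: binom_coeff_def power2_eq_square add.commute mult_ac)
  qed
  also have "(\<Sum>n. ennreal (Gamma a * Gamma (2 - a) * ((binom_coeff a n)\<^sup>2 / (real n + 1)))) = ennreal (Gamma a * Gamma (2 - a) * hyper_sum a)"
    using G by (intro suminf_ennreal_eq sums_mult sums_hyper_sum) auto
  finally have "Beta a (2 - 2 * a) = Gamma a * Gamma (2 - a) * hyper_sum a"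
    using G a sums_le[OF _ sums_zero sums_hyper_sum]
    by (subst (asm) ennreal_inj) (auto simp: Beta_def)
  moreover have "Beta a (2 - 2 * a) = Gamma a * Gamma (2 - 2 * a) / Gamma (2 - a)"
    by (simp add: Beta_def)
  ultimately show ?thesis using G by (simp add: field_simps power2_eq_square)
qed

end

section \<open>Riesz potentials of the disk\<close>

lemma nn_integral_power_Ioo:
  assumes "0 \<le> x"
  shows "(\<integral>\<^sup>+t. ennreal (t ^ n) * indicator {0<..<x} t \<partial>lborel) = ennreal (x ^ Suc n / (real n + 1))"
proof (rule nn_integral_has_integral_lebesgue')
  have "((\<lambda>t. t ^ n) has_integral x ^ Suc n / (real n + 1) - 0 ^ Suc n / (real n + 1)) {0..x}"
  proof (rule fundamental_theorem_of_calculus)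
    fix t
    have "((\<lambda>t. t ^ Suc n / (real n + 1)) has_real_derivative t ^ n) (at t within {0..x})"
      by (auto intro!: derivative_eq_intros simp: divide_simps simp del: power_Suc)
    then show "((\<lambda>t. t ^ Suc n / (real n + 1)) has_vector_derivative t ^ n) (at t within {0..x})"
      by (simp add: has_real_derivative_iff_has_vector_derivative del: power_Suc)
  qed (use assms in auto)
  then show "((\<lambda>t. t ^ n) has_integral x ^ Suc n / (real n + 1)) {0<..<x}"
    by (simp add: has_integral_Icc_iff_Ioo)
qed auto

lemma nn_integral_powr_Ioo:
  assumes "0 < x" "x \<le> 1" "s \<noteq> 1"
  shows "(\<integral>\<^sup>+t. ennreal (t powr (- s)) * indicator {x<..<1} t \<partial>lborel) = ennreal ((1 - x powr (1 - s)) / (1 - s))"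
proof (rule nn_integral_has_integral_lebesgue')
  have "((\<lambda>t. t powr (- s)) has_integral 1 powr (1 - s) / (1 - s) - x powr (1 - s) / (1 - s)) {x..1}"
  proof (rule fundamental_theorem_of_calculus)
    fix t assume "t \<in> {x..1}"
    then have "((\<lambda>t. t powr (1 - s) / (1 - s)) has_real_derivative t powr (- s)) (at t within {x..1})"
      using assms by (auto intro!: derivative_eq_intros)
    then show "((\<lambda>t. t powr (1 - s) / (1 - s)) has_vector_derivative t powr (- s)) (at t within {x..1})"
      by (simp add: has_real_derivative_iff_has_vector_derivative)
  qed (use assms in auto)
  then show "((\<lambda>t. t powr (- s)) has_integral (1 - x powr (1 - s)) / (1 - s)) {x<..<1}"
    by (simp add: has_integral_Icc_iff_Ioo diff_divide_distrib)
qed auto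

lemma norm_powr_two_mult: "norm z powr (2 * s) = ((norm z)\<^sup>2) powr s"
  by (cases "z = 0") (simp_all add: powr_powr flip: powr_numeral)

lemma norm_power_two_mult: "norm z ^ (2 * n) = ((norm z)\<^sup>2) ^ n"
  by (rule power_mult)

text \<open>The uniform law of |w|^2 has no atoms. This discards the circle |w| = |z|, where neither
  expansion of the kernel converges absolutely under a strict bound, and the point z = 0, where the
  reflected point is missing.\<close>

lemma AE_dA_norm_neq: "AE w in dA. norm w \<noteq> r"
proof (cases "0 \<le> r")
  case True
  have "(\<integral>\<^sup>+w. indicator {r\<^sup>2} ((norm w)\<^sup>2) \<partial>dA) = (\<integral>\<^sup>+t. indicator {r\<^sup>2} t * indicator {0<..<1} t \<partial>lborel)"
    by (rule nn_integral_dA_norm_squared) auto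
  also have "\<dots> \<le> (\<integral>\<^sup>+t. indicator {r\<^sup>2} t \<partial>lborel)"
    by (intro nn_integral_mono) (auto simp: indicator_def)
  finally have "(\<integral>\<^sup>+w. indicator {r\<^sup>2} ((norm w)\<^sup>2) \<partial>dA) = 0"
    by simp
  then have "AE w in dA. indicator {r\<^sup>2} ((norm w)\<^sup>2) = (0::ennreal)"
    by (subst (asm) nn_integral_0_iff_AE) (auto intro!: borel_measurable_dA)
  then show ?thesis
    by eventually_elim (auto simp: indicator_def split: if_splits)
next
  case False
  then show ?thesis by (auto intro: AE_I2)
qed

context
  fixes a :: real
  assumes a: "0 < a" "a < 1"
begin

text \<open>In the open disk |c w| < 1 even when |c| = 1, so one expansion covers both the reflected
  potential (c = \<open>cnj z\<close>) and the boundary value U(1) (c = 1) without a limit.\<close>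

lemma nn_integral_one_minus_mult:
  fixes c :: complex
  assumes c: "norm c \<le> 1"
  shows "(\<integral>\<^sup>+w. ennreal (norm (1 - c * w) powr (- 2 * a)) \<partial>dA) =
    (\<Sum>n. ennreal ((binom_coeff a n)\<^sup>2 * (((norm c)\<^sup>2) ^ n / (real n + 1))))"
proof -
  have "(\<integral>\<^sup>+w. ennreal (norm (1 - c * w) powr (- 2 * a)) \<partial>dA) =
      (\<integral>\<^sup>+w. 1 * ennreal (norm (1 - c * w) powr (- 2 * a)) \<partial>dA)" by simp
  also have "\<dots> = (\<Sum>n. ennreal ((binom_coeff a n)\<^sup>2) * (\<integral>\<^sup>+w. 1 * ennreal (norm (c * w) ^ (2 * n)) \<partial>dA))"
  proof (rule nn_integral_dA_radial_times_norm_powr)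
    fix w :: complex assume "norm w < 1"
    then have "norm (c * w) < 1"
      using mult_right_mono[OF c, of "norm w"] by (simp add: norm_mult)
    then show "(1::ennreal) = 0 \<or> norm (c * w) < 1" by simp
  qed (use a in \<open>auto simp: mult_ac\<close>)
  also have "(\<lambda>n. ennreal ((binom_coeff a n)\<^sup>2) * (\<integral>\<^sup>+w. 1 * ennreal (norm (c * w) ^ (2 * n)) \<partial>dA)) =
    (\<lambda>n. ennreal ((binom_coeff a n)\<^sup>2 * (((norm c)\<^sup>2) ^ n / (real n + 1))))"
  proof
    fix n
    have "(\<integral>\<^sup>+w. 1 * ennreal (norm (c * w) ^ (2 * n)) \<partial>dA) =
        (\<integral>\<^sup>+w. ennreal (((norm c)\<^sup>2) ^ n) * ennreal (((norm w)\<^sup>2) ^ n) \<partial>dA)"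
      by (simp add: norm_mult power_mult_distrib norm_power_two_mult ennreal_mult)
    also have "\<dots> = (\<integral>\<^sup>+t. ennreal (((norm c)\<^sup>2) ^ n) * ennreal (t ^ n) * indicator {0<..<1} t \<partial>lborel)"
      by (rule nn_integral_dA_norm_squared) measurable
    also have "\<dots> = ennreal (((norm c)\<^sup>2) ^ n) * (\<integral>\<^sup>+t. ennreal (t ^ n) * indicator {0<..<1} t \<partial>lborel)"
      unfolding mult.assoc by (rule nn_integral_cmult) measurable
    also have "\<dots> = ennreal (((norm c)\<^sup>2) ^ n / (real n + 1))"
      by (subst nn_integral_power_Ioo) (auto simp: ennreal_mult[symmetric])
    finally show "ennreal ((binom_coeff a n)\<^sup>2) * (\<integral>\<^sup>+w. 1 * ennreal (norm (c * w) ^ (2 * n)) \<partial>dA) =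
      ennreal ((binom_coeff a n)\<^sup>2 * (((norm c)\<^sup>2) ^ n / (real n + 1)))"
      by (simp only: ennreal_mult' zero_le_power2)
  qed
  finally show ?thesis .
qed

lemma nn_integral_one_minus:
  "(\<integral>\<^sup>+w. ennreal (norm (1 - w) powr (- 2 * a)) \<partial>dA) = ennreal (hyper_sum a)"
proof -
  have "(\<Sum>n. ennreal ((binom_coeff a n)\<^sup>2 * (((norm (1::complex))\<^sup>2) ^ n / (real n + 1)))) = ennreal (hyper_sum a)"
    using sums_hyper_sum[OF a] by (intro suminf_ennreal_eq) auto
  with nn_integral_one_minus_mult[of 1, OF eq_refl[OF norm_one]] show ?thesis
    by (simp only: mult_1)
qed

text \<open>Here |w - z| = |z| |1 - w / z|, and the expansion runs in w / z. Integrating (t / x)^n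
  up to x gives x / (n + 1), so all terms carry the same power x^(1-a).\<close>

lemma nn_integral_inside:
  fixes z :: complex
  assumes z: "z \<noteq> 0" "norm z < 1"
  defines "x \<equiv> (norm z)\<^sup>2"
  shows "(\<integral>\<^sup>+w. ennreal (norm (w - z) powr (- 2 * a)) * indicator {w. norm w < norm z} w \<partial>dA) =
    (\<Sum>n. ennreal ((binom_coeff a n)\<^sup>2 * (x powr (1 - a) / (real n + 1))))"
proof -
  define g where "g w = ennreal (x powr (- a)) * indicator {w. norm w < norm z} w" for w :: complex
  have x: "0 < x" "x < 1" using z by (auto simp: x_def abs_square_less_1)
  have le: "norm w < norm z \<longleftrightarrow> (norm w)\<^sup>2 < x" for w :: complex
    unfolding x_def by (auto intro: power_strict_mono power_less_imp_less_base)
  have [measurable]: "g \<in> borel_measurable borel" unfolding g_def[abs_def] by measurable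
  have "ennreal (norm (w - z) powr (- 2 * a)) * indicator {w. norm w < norm z} w = g w * ennreal (norm (1 - w / z) powr (- 2 * a))" for w
  proof -
    have "norm (w - z) = norm z * norm (1 - w / z)"
      using z by (simp add: norm_mult[symmetric] right_diff_distrib norm_minus_commute)
    then have "norm (w - z) powr (- 2 * a) = x powr (- a) * norm (1 - w / z) powr (- 2 * a)"
      using norm_powr_two_mult[of z "- a"] by (simp add: powr_mult x_def)
    then show ?thesis by (simp add: g_def ennreal_mult mult_ac)
  qed
  then have "(\<integral>\<^sup>+w. ennreal (norm (w - z) powr (- 2 * a)) * indicator {w. norm w < norm z} w \<partial>dA) =
     (\<integral>\<^sup>+w. g w * ennreal (norm (1 - w / z) powr (- 2 * a)) \<partial>dA)" by simp
  also have "\<dots> = (\<Sum>n. ennreal ((binom_coeff a n)\<^sup>2) * (\<integral>\<^sup>+w. g w * ennreal (norm (w / z) ^ (2 * n)) \<partial>dA))"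
  proof (rule nn_integral_dA_radial_times_norm_powr)
    show "g w = 0 \<or> norm (w / z) < 1" for w
      using z by (auto simp: g_def norm_divide)
  qed (use a in \<open>auto simp: g_def norm_mult indicator_def\<close>)
  also have "(\<lambda>n. ennreal ((binom_coeff a n)\<^sup>2) * (\<integral>\<^sup>+w. g w * ennreal (norm (w / z) ^ (2 * n)) \<partial>dA)) =
    (\<lambda>n. ennreal ((binom_coeff a n)\<^sup>2 * (x powr (1 - a) / (real n + 1))))"
  proof
    fix n
    have "g w * ennreal (norm (w / z) ^ (2 * n)) = ennreal (x powr (- a) / x ^ n) * (ennreal (((norm w)\<^sup>2) ^ n) * indicator {..<x} ((norm w)\<^sup>2))" for w
      using x by (auto simp: g_def norm_power_two_mult norm_divide power_divide le x_def[symmetric] ennreal_mult[symmetric] split: split_indicator)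
    then have "(\<integral>\<^sup>+w. g w * ennreal (norm (w / z) ^ (2 * n)) \<partial>dA) =
        (\<integral>\<^sup>+w. ennreal (x powr (- a) / x ^ n) * (ennreal (((norm w)\<^sup>2) ^ n) * indicator {..<x} ((norm w)\<^sup>2)) \<partial>dA)"
      by simp
    also have "\<dots> = (\<integral>\<^sup>+t. ennreal (x powr (- a) / x ^ n) * (ennreal (t ^ n) * indicator {..<x} t) * indicator {0<..<1} t \<partial>lborel)"
      by (rule nn_integral_dA_norm_squared) measurable
    also have "\<dots> = (\<integral>\<^sup>+t. ennreal (x powr (- a) / x ^ n) * (ennreal (t ^ n) * indicator {0<..<x} t) \<partial>lborel)"
      using x by (intro nn_integral_cong) (auto split: split_indicator)
    also have "\<dots> = ennreal (x powr (- a) / x ^ n) * (\<integral>\<^sup>+t. ennreal (t ^ n) * indicator {0<..<x} t \<partial>lborel)"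
      by (rule nn_integral_cmult) measurable
    also have "\<dots> = ennreal (x powr (- a) / x ^ n * (x ^ Suc n / (real n + 1)))"
      using x by (subst nn_integral_power_Ioo) (auto simp: ennreal_mult[symmetric])
    also have "x powr (- a) / x ^ n * (x ^ Suc n / (real n + 1)) = x powr (1 - a) / (real n + 1)"
      using x by (simp add: powr_diff powr_minus divide_simps)
    finally show "ennreal ((binom_coeff a n)\<^sup>2) * (\<integral>\<^sup>+w. g w * ennreal (norm (w / z) ^ (2 * n)) \<partial>dA) =
      ennreal ((binom_coeff a n)\<^sup>2 * (x powr (1 - a) / (real n + 1)))"
      by (simp only: ennreal_mult' zero_le_power2)
  qed
  finally show ?thesis .
qed

text \<open>Here |w - z| = |w| |1 - z / w|; the radial weight |w|^(-2a) goes into \<open>g\<close>,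
  and z / w turns against w. As a is no integer, the exponent - (a + n) is never -1 and no logarithm
  appears.\<close>

lemma nn_integral_outside:
  fixes z :: complex
  assumes z: "z \<noteq> 0" "norm z < 1"
  defines "x \<equiv> (norm z)\<^sup>2"
  shows "(\<integral>\<^sup>+w. ennreal (norm (w - z) powr (- 2 * a)) * indicator {w. norm z < norm w} w \<partial>dA) =
    (\<Sum>n. ennreal ((binom_coeff a n)\<^sup>2 * ((x ^ n - x powr (1 - a)) / (1 - a - real n))))"
proof -
  define g where "g w = ennreal (norm w powr (- 2 * a)) * indicator {w. norm z < norm w} w" for w :: complex
  have x: "0 < x" "x < 1" using z by (auto simp: x_def abs_square_less_1)
  have le: "norm z < norm w \<longleftrightarrow> x < (norm w)\<^sup>2" for w :: complex
    unfolding x_def by (auto intro: power_strict_mono power_less_imp_less_base)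
  have [measurable]: "g \<in> borel_measurable borel" unfolding g_def[abs_def] by measurable
  have "ennreal (norm (w - z) powr (- 2 * a)) * indicator {w. norm z < norm w} w = g w * ennreal (norm (1 - z / w) powr (- 2 * a))" for w
  proof (cases "norm z < norm w")
    case True
    then have "w \<noteq> 0" by auto
    then have "norm (w - z) = norm w * norm (1 - z / w)"
      by (simp add: norm_mult[symmetric] right_diff_distrib)
    then have "norm (w - z) powr (- 2 * a) = norm w powr (- 2 * a) * norm (1 - z / w) powr (- 2 * a)"
      by (simp add: powr_mult)
    then show ?thesis by (simp add: g_def ennreal_mult mult_ac)
  qed (simp add: g_def)
  then have "(\<integral>\<^sup>+w. ennreal (norm (w - z) powr (- 2 * a)) * indicator {w. norm z < norm w} w \<partial>dA) =
     (\<integral>\<^sup>+w. g w * ennreal (norm (1 - z / w) powr (- 2 * a)) \<partial>dA)" by simp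
  also have "\<dots> = (\<Sum>n. ennreal ((binom_coeff a n)\<^sup>2) * (\<integral>\<^sup>+w. g w * ennreal (norm (z / w) ^ (2 * n)) \<partial>dA))"
  proof (rule nn_integral_dA_radial_times_norm_powr)
    show "g w = 0 \<or> norm (z / w) < 1" for w
      using z by (auto simp: g_def norm_divide divide_less_eq)
    have "z / (cis \<theta> * w) = cis (- \<theta>) * (z / w)" for \<theta> w
      by (simp add: cis_inverse[symmetric] field_simps)
    then show "(\<forall>\<theta> w. z / (cis \<theta> * w) = cis \<theta> * (z / w)) \<or> (\<forall>\<theta> w. z / (cis \<theta> * w) = cis (- \<theta>) * (z / w))"
      by blast
  qed (use a in \<open>auto simp: g_def norm_mult indicator_def\<close>)
  also have "(\<lambda>n. ennreal ((binom_coeff a n)\<^sup>2) * (\<integral>\<^sup>+w. g w * ennreal (norm (z / w) ^ (2 * n)) \<partial>dA)) =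
    (\<lambda>n. ennreal ((binom_coeff a n)\<^sup>2 * ((x ^ n - x powr (1 - a)) / (1 - a - real n))))"
  proof
    fix n
    have n1: "a + real n \<noteq> 1" using a by (cases n) auto
    have "g w * ennreal (norm (z / w) ^ (2 * n)) = ennreal (x ^ n) * (ennreal (((norm w)\<^sup>2) powr (- (a + real n))) * indicator {x<..} ((norm w)\<^sup>2))" for w
    proof (cases "norm z < norm w")
      case True
      then have w: "0 < (norm w)\<^sup>2" by auto
      have "norm w powr (- 2 * a) * norm (z / w) ^ (2 * n) = ((norm w)\<^sup>2) powr (- a) * (x ^ n / ((norm w)\<^sup>2) ^ n)"
        using norm_powr_two_mult[of w "- a"]
        by (simp add: norm_power_two_mult norm_divide power_divide x_def)
      also have "\<dots> = x ^ n * ((norm w)\<^sup>2) powr (- (a + real n))"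
      proof -
        have "((norm w)\<^sup>2) powr (- (a + real n)) = ((norm w)\<^sup>2) powr (- a) * ((norm w)\<^sup>2) powr (- real n)"
          by (simp flip: powr_add)
        also have "((norm w)\<^sup>2) powr (- real n) = 1 / ((norm w)\<^sup>2) ^ n"
          using w by (simp only: powr_minus_divide powr_realpow)
        finally show ?thesis by simp
      qed
      finally show ?thesis
        using True x by (simp add: g_def le ennreal_mult[symmetric])
    qed (simp add: g_def le)
    then have "(\<integral>\<^sup>+w. g w * ennreal (norm (z / w) ^ (2 * n)) \<partial>dA) =
        (\<integral>\<^sup>+w. ennreal (x ^ n) * (ennreal (((norm w)\<^sup>2) powr (- (a + real n))) * indicator {x<..} ((norm w)\<^sup>2)) \<partial>dA)"
      by simp
    also have "\<dots> = (\<integral>\<^sup>+t. ennreal (x ^ n) * (ennreal (t powr (- (a + real n))) * indicator {x<..} t) * indicator {0<..<1} t \<partial>lborel)"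
      by (rule nn_integral_dA_norm_squared) measurable
    also have "\<dots> = (\<integral>\<^sup>+t. ennreal (x ^ n) * (ennreal (t powr (- (a + real n))) * indicator {x<..<1} t) \<partial>lborel)"
      using x by (intro nn_integral_cong) (auto split: split_indicator)
    also have "\<dots> = ennreal (x ^ n) * (\<integral>\<^sup>+t. ennreal (t powr (- (a + real n))) * indicator {x<..<1} t \<partial>lborel)"
      by (rule nn_integral_cmult) measurable
    also have "\<dots> = ennreal (x ^ n) * ennreal ((1 - x powr (1 - (a + real n))) / (1 - (a + real n)))"
      using x n1 by (subst nn_integral_powr_Ioo) auto
    also have "\<dots> = ennreal (x ^ n * ((1 - x powr (1 - (a + real n))) / (1 - (a + real n))))"
      using x by (intro ennreal_mult'[symmetric]) simp
    also have "x ^ n * ((1 - x powr (1 - (a + real n))) / (1 - (a + real n))) = (x ^ n - x powr (1 - a)) / (1 - a - real n)"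
    proof -
      have "x ^ n * x powr (1 - (a + real n)) = x powr (real n + (1 - (a + real n)))"
        using x by (simp only: powr_add powr_realpow)
      then have "x ^ n * x powr (1 - (a + real n)) = x powr (1 - a)" by simp
      then show ?thesis by (simp add: right_diff_distrib diff_diff_eq)
    qed
    finally show "ennreal ((binom_coeff a n)\<^sup>2) * (\<integral>\<^sup>+w. g w * ennreal (norm (z / w) ^ (2 * n)) \<partial>dA) =
      ennreal ((binom_coeff a n)\<^sup>2 * ((x ^ n - x powr (1 - a)) / (1 - a - real n)))"
      by (simp only: ennreal_mult' zero_le_power2)
  qed
  finally show ?thesis .
qed

text \<open>The second integrand is the kernel of the reflected point: |z| / |1 - cnj w z| = 1 / |w
  - 1 / cnj z|. Hence the left side is U(z) + U(1 / cnj z), evaluated by the expansions and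
  estimated by \<open>potential_sums\<close>.\<close>

lemma potential_bound:
  fixes z :: complex
  assumes z: "z \<noteq> 0" "norm z < 1"
  shows "(\<integral>\<^sup>+w. ennreal (norm (w - z) powr (- 2 * a)) \<partial>dA) +
      (\<integral>\<^sup>+w. ennreal ((norm z / norm (1 - cnj w * z)) powr (2 * a)) \<partial>dA) \<le> ennreal (2 * hyper_sum a)"
proof -
  define x where "x = (norm z)\<^sup>2"
  have x: "0 < x" "x < 1" using z by (auto simp: x_def abs_square_less_1)
  define p q where "p n = x powr (1 - a) / (real n + 1)"
    and "q n = (x ^ n - x powr (1 - a)) / (1 - a - real n)" for n
  let ?F = "\<lambda>w. ennreal (norm (w - z) powr (- 2 * a))"
  have p0: "0 \<le> p n" for n by (simp add: p_def)
  \<comment> \<open>Numerator and denominator change sign together, since 1 - a lies strictly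
    between 0 and 1. Nonnegativity is what allows the real series to be read as sums in
    \<open>ennreal\<close>.\<close>
  have q0: "0 \<le> q n" for n
  proof (cases n)
    case 0
    then show ?thesis using a x by (simp add: q_def powr_le1)
  next
    case (Suc m)
    have "x powr real n \<le> x powr (1 - a)"
      using x a Suc by (intro powr_mono') auto
    then have "x ^ n - x powr (1 - a) \<le> 0" using x by (simp only: powr_realpow)
    moreover have "1 - a - real n \<le> 0" using a Suc by simp
    ultimately show ?thesis unfolding q_def by (rule divide_nonpos_nonpos)
  qed
  obtain A B where AB: "(\<lambda>n. (binom_coeff a n)\<^sup>2 * (p n + q n)) sums A"
      "(\<lambda>n. (binom_coeff a n)\<^sup>2 * (x powr a * x ^ n / (real n + 1))) sums B" "A + B \<le> 2 * hyper_sum a"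
    using potential_sums[OF a x] unfolding p_def q_def by blast
  have "(\<integral>\<^sup>+w. ?F w \<partial>dA) =
      (\<integral>\<^sup>+w. ?F w * indicator {w. norm w < norm z} w + ?F w * indicator {w. norm z < norm w} w \<partial>dA)"
    using AE_dA_norm_neq[of "norm z"]
    by (intro nn_integral_cong_AE) (auto elim!: eventually_mono split: split_indicator)
  also have "\<dots> = (\<integral>\<^sup>+w. ?F w * indicator {w. norm w < norm z} w \<partial>dA) + (\<integral>\<^sup>+w. ?F w * indicator {w. norm z < norm w} w \<partial>dA)"
    by (intro nn_integral_add borel_measurable_dA) measurable
  also have "\<dots> = (\<Sum>n. ennreal ((binom_coeff a n)\<^sup>2 * p n)) + (\<Sum>n. ennreal ((binom_coeff a n)\<^sup>2 * q n))"
    using nn_integral_inside[OF z] nn_integral_outside[OF z] by (simp only: p_def q_def x_def)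
  also have "\<dots> = (\<Sum>n. ennreal ((binom_coeff a n)\<^sup>2 * p n) + ennreal ((binom_coeff a n)\<^sup>2 * q n))"
    by (rule suminf_add) auto
  also have "\<dots> = (\<Sum>n. ennreal ((binom_coeff a n)\<^sup>2 * (p n + q n)))"
    using p0 q0 by (simp add: distrib_left)
  also have "\<dots> = ennreal A"
    using AB(1) p0 q0 by (intro suminf_ennreal_eq) auto
  finally have 1: "(\<integral>\<^sup>+w. ?F w \<partial>dA) = ennreal A" .
  have "ennreal ((norm z / norm (1 - cnj w * z)) powr (2 * a)) = ennreal (x powr a) * ennreal (norm (1 - cnj z * w) powr (- 2 * a))" for w
  proof -
    have "norm (1 - cnj w * z) = norm (cnj (1 - cnj w * z))" by (rule complex_mod_cnj[symmetric])
    also have "cnj (1 - cnj w * z) = 1 - cnj z * w" by (simp add: mult.commute)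
    finally have "(norm z / norm (1 - cnj w * z)) powr (2 * a) = norm z powr (2 * a) * norm (1 - cnj z * w) powr (- 2 * a)"
      by (simp add: powr_divide powr_minus_divide)
    then show ?thesis by (simp add: norm_powr_two_mult[of z] x_def ennreal_mult)
  qed
  then have "(\<integral>\<^sup>+w. ennreal ((norm z / norm (1 - cnj w * z)) powr (2 * a)) \<partial>dA) =
      ennreal (x powr a) * (\<integral>\<^sup>+w. ennreal (norm (1 - cnj z * w) powr (- 2 * a)) \<partial>dA)"
    by (simp only:) (intro nn_integral_cmult borel_measurable_dA; measurable)
  also have "\<dots> = ennreal (x powr a) * (\<Sum>n. ennreal ((binom_coeff a n)\<^sup>2 * (x ^ n / (real n + 1))))"
    using z by (subst nn_integral_one_minus_mult) (simp_all add: x_def)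
  also have "\<dots> = (\<Sum>n. ennreal ((binom_coeff a n)\<^sup>2 * (x powr a * x ^ n / (real n + 1))))"
    using x by (subst ennreal_suminf_cmult[symmetric]) (simp add: ennreal_mult[symmetric] mult_ac)
  also have "\<dots> = ennreal B"
    using AB(2) x by (intro suminf_ennreal_eq) auto
  finally have 2: "(\<integral>\<^sup>+w. ennreal ((norm z / norm (1 - cnj w * z)) powr (2 * a)) \<partial>dA) = ennreal B" .
  have "0 \<le> A" "0 \<le> B"
    using p0 q0 x by (auto intro!: sums_le[OF _ sums_zero AB(1)] sums_le[OF _ sums_zero AB(2)])
  then show ?thesis unfolding 1 2 using AB(3) by (simp add: ennreal_plus[symmetric] ennreal_leI del: ennreal_plus)
qed

end

section \<open>The upper bound\<close>

text \<open>An integral depending on a parameter is measurable when the integrand is jointly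
  measurable; \<open>esssup_I\<close> asks for this.\<close>

lemma cauchyP_measurable:
  assumes [measurable]: "\<phi> \<in> borel_measurable dA"
  shows "cauchyP \<phi> \<in> borel_measurable dA"
proof -
  have idm [measurable]: "(\<lambda>w. w) \<in> dA \<rightarrow>\<^sub>M borel"
    by (rule borel_measurable_dA) simp
  note cm [measurable] = borel_measurable_cnj
  have f: "(\<lambda>p. fst p) \<in> borel_measurable (dA \<Otimes>\<^sub>M dA)" and s: "(\<lambda>p. snd p) \<in> borel_measurable (dA \<Otimes>\<^sub>M dA)"
    using measurable_compose[OF measurable_fst idm] measurable_compose[OF measurable_snd idm] by auto
  have ph: "(\<lambda>p. \<phi> (snd p)) \<in> borel_measurable (dA \<Otimes>\<^sub>M dA)" by measurable
  have "(\<lambda>(z, w). \<phi> w / (w - z) + z * cnj (\<phi> w) / (1 - cnj w * z)) \<in> borel_measurable (dA \<Otimes>\<^sub>M dA)"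
    using f s ph measurable_compose[OF ph cm] measurable_compose[OF s cm]
    unfolding case_prod_beta' by (intro borel_measurable_add borel_measurable_divide borel_measurable_diff borel_measurable_times) auto
  then show ?thesis
    unfolding cauchyP_def[abs_def]
    by (intro borel_measurable_uminus dA.borel_measurable_lebesgue_integral)
qed

lemma norm_cauchyP_le:
  "ennreal (norm (cauchyP \<phi> z)) \<le>
    (\<integral>\<^sup>+w. ennreal (norm (\<phi> w) * (1 / norm (w - z)) + norm (\<phi> w) * (norm z / norm (1 - cnj w * z))) \<partial>dA)"
proof (cases "integrable dA (\<lambda>w. \<phi> w / (w - z) + z * cnj (\<phi> w) / (1 - cnj w * z))")
  case True
  have "ennreal (norm (cauchyP \<phi> z)) \<le> (\<integral>\<^sup>+w. ennreal (norm (\<phi> w / (w - z) + z * cnj (\<phi> w) / (1 - cnj w * z))) \<partial>dA)"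
    unfolding cauchyP_def norm_minus_cancel using True by (rule integral_norm_bound_ennreal)
  also have "\<dots> \<le> (\<integral>\<^sup>+w. ennreal (norm (\<phi> w) * (1 / norm (w - z)) + norm (\<phi> w) * (norm z / norm (1 - cnj w * z))) \<partial>dA)"
  proof (intro nn_integral_mono ennreal_leI)
    fix w
    have "norm (\<phi> w / (w - z) + z * cnj (\<phi> w) / (1 - cnj w * z)) \<le> norm (\<phi> w / (w - z)) + norm (z * cnj (\<phi> w) / (1 - cnj w * z))"
      by (rule norm_triangle_ineq)
    then show "norm (\<phi> w / (w - z) + z * cnj (\<phi> w) / (1 - cnj w * z)) \<le> norm (\<phi> w) * (1 / norm (w - z)) + norm (\<phi> w) * (norm z / norm (1 - cnj w * z))"
      by (simp add: norm_mult norm_divide mult.commute)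
  qed
  finally show ?thesis .
next
  \<comment> \<open>A non-integrable kernel makes the Bochner integral 0 by convention, so the
    estimate holds without any integrability assumption.\<close>
  case False
  then show ?thesis by (simp add: cauchyP_def not_integrable_integral_eq)
qed

text \<open>The origin is a null set, so it may be left out of the pointwise bound, as the
  reflection at the unit circle requires.\<close>

lemma Linf_norm_cauchyP_le:
  assumes "\<phi> \<in> borel_measurable dA" and "0 \<le> C"
    and "\<And>z. z \<noteq> 0 \<Longrightarrow> norm z < 1 \<Longrightarrow> ennreal (norm (cauchyP \<phi> z)) \<le> ennreal C"
  shows "Linf_norm (cauchyP \<phi>) \<le> ereal C"
  unfolding Linf_norm_def
proof (rule esssup_I)
  show "(\<lambda>w. ereal (norm (cauchyP \<phi> w))) \<in> borel_measurable dA"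
    using cauchyP_measurable[OF assms(1)] by measurable
  show "AE w in dA. ereal (norm (cauchyP \<phi> w)) \<le> ereal C"
    using AE_dA_norm_neq[of 0] AE_space
  proof eventually_elim
    case (elim w)
    then show ?case using assms(3)[of w] assms(2) by (simp add: space_dA)
  qed
qed

lemma hyper_sum_pos:
  assumes "0 < a" "a < 1"
  shows "0 < hyper_sum a"
proof -
  have "0 < Gamma (2 - 2 * a)" "0 < Gamma (2 - a)"
    using assms by (auto intro!: Gamma_real_pos)
  then show ?thesis by (simp add: hyper_sum_eq_Gamma[OF assms])
qed

text \<open>The condition p > 2 is q < 2, that is a = q / 2 < 1: exactly local integrability of |w -
  z|^(-q) in the plane. The last identity is the equality case of Hoelder's inequality.\<close>

lemma conjugate_exponent:
  fixes p :: real
  assumes "2 < p"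
  defines "q \<equiv> p / (p - 1)"
  shows "1 < q" "q < 2" "1 / p + 1 / q = 1" "(q - 1) * p = q"
  using assms by (auto simp: field_simps)

text \<open>Young's inequality is applied to both halves of the kernel with the same weight, so the
  q-th powers enter only through U(z) + U(1 / cnj z).\<close>

lemma Linf_norm_cauchyP_le_Lp:
  assumes p: "2 < p" and q: "q = p / (p - 1)"
    and \<phi>: "in_Lp p \<phi>" "Lp_norm p \<phi> = 1"
  shows "Linf_norm (cauchyP \<phi>) \<le> ereal (2 * hyper_sum (q / 2) powr (1 / q))"
proof (rule Linf_norm_cauchyP_le)
  note pq = conjugate_exponent[OF p, folded q]
  define S where "S = hyper_sum (q / 2)"
  \<comment> \<open>The final bound is 2 \<tau>^p / p + 2 S / (q \<tau>^q); its minimum over \<tau>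
    lies at \<tau>^(p+q) = S, and p + q = p q. The two summands then become S^(1/q) times 2 / p and
    2 / q.\<close>
  define \<tau> where "\<tau> = S powr (1 / (p * q))"
  have a: "0 < q / 2" "q / 2 < 1" using pq by auto
  have S: "0 < S" unfolding S_def by (rule hyper_sum_pos[OF a])
  then have \<tau>: "0 < \<tau>" by (simp add: \<tau>_def)
  have \<tau>p: "\<tau> powr p = S powr (1 / q)" and \<tau>q: "\<tau> powr q = S powr (1 / p)"
    using p pq by (simp_all add: \<tau>_def powr_powr)
  show m: "\<phi> \<in> borel_measurable dA" using \<phi> by (simp add: in_Lp_def)
  show "0 \<le> 2 * hyper_sum (q / 2) powr (1 / q)" by simp
  have int: "integrable dA (\<lambda>w. norm (\<phi> w) powr p)" using \<phi> by (simp add: in_Lp_def)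
  have "(LINT w|dA. norm (\<phi> w) powr p) = 1"
  proof -
    define I where "I = (LINT w|dA. norm (\<phi> w) powr p)"
    have I: "0 \<le> I" "I powr (1 / p) = 1"
      using \<phi>(2) by (auto simp: I_def Lp_norm_def intro: integral_nonneg_AE)
    then have "0 < I" by (cases "I = 0") auto
    have "I = (I powr (1 / p)) powr p" using p \<open>0 < I\<close> by (simp add: powr_powr)
    then show ?thesis using I by (simp add: I_def)
  qed
  then have phi1: "(\<integral>\<^sup>+w. ennreal (norm (\<phi> w) powr p) \<partial>dA) = 1"
    using nn_integral_eq_integral[OF int] by simp
  fix z :: complex assume z: "z \<noteq> 0" "norm z < 1"
  let ?f = "\<lambda>w. norm (w - z) powr (- 2 * (q / 2))"
  let ?g = "\<lambda>w. (norm z / norm (1 - cnj w * z)) powr (2 * (q / 2))"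
  have young: "norm (\<phi> w) * y \<le> (\<tau> powr p / p) * norm (\<phi> w) powr p + (1 / (q * \<tau> powr q)) * y powr q" if "0 \<le> y" for y w
  proof -
    have "(\<tau> * norm (\<phi> w)) * (y / \<tau>) \<le> (\<tau> * norm (\<phi> w)) powr p / p + (y / \<tau>) powr q / q"
      using p pq \<tau> that by (intro Youngs_inequality) auto
    then show ?thesis
      using \<tau> that by (simp add: powr_mult powr_divide mult_ac)
  qed
  have gm: "?g \<in> borel_measurable dA" "?f \<in> borel_measurable dA"
    using borel_measurable_cnj by (auto intro!: borel_measurable_dA)
  have "ennreal (norm (cauchyP \<phi> z)) \<le>
    (\<integral>\<^sup>+w. ennreal (norm (\<phi> w) * (1 / norm (w - z)) + norm (\<phi> w) * (norm z / norm (1 - cnj w * z))) \<partial>dA)"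
    by (rule norm_cauchyP_le)
  also have "\<dots> \<le> (\<integral>\<^sup>+w. ennreal (2 * \<tau> powr p / p) * ennreal (norm (\<phi> w) powr p) + ennreal (1 / (q * \<tau> powr q)) * (ennreal (?f w) + ennreal (?g w)) \<partial>dA)"
  proof (intro nn_integral_mono)
    fix w
    have "(1 / norm (w - z)) powr q = ?f w" by (simp add: powr_divide powr_minus_divide)
    then have "norm (\<phi> w) * (1 / norm (w - z)) + norm (\<phi> w) * (norm z / norm (1 - cnj w * z)) \<le>
        (2 * \<tau> powr p / p) * norm (\<phi> w) powr p + (1 / (q * \<tau> powr q)) * (?f w + ?g w)"
      using young[of "1 / norm (w - z)" w] young[of "norm z / norm (1 - cnj w * z)" w]
      by (simp add: distrib_left)
    then have "ennreal (norm (\<phi> w) * (1 / norm (w - z)) + norm (\<phi> w) * (norm z / norm (1 - cnj w * z))) \<le>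
        ennreal ((2 * \<tau> powr p / p) * norm (\<phi> w) powr p + (1 / (q * \<tau> powr q)) * (?f w + ?g w))"
      by (rule ennreal_leI)
    also have "\<dots> = ennreal (2 * \<tau> powr p / p) * ennreal (norm (\<phi> w) powr p) + ennreal (1 / (q * \<tau> powr q)) * (ennreal (?f w) + ennreal (?g w))"
    proof -
      have "ennreal (A * B + C * (D + E)) = ennreal A * ennreal B + ennreal C * (ennreal D + ennreal E)"
        if "0 \<le> A" "0 \<le> B" "0 \<le> C" "0 \<le> D" "0 \<le> E" for A B C D E
        using that by (simp add: ennreal_mult)
      then show ?thesis by this (use p pq \<tau> in auto)
    qed
    finally show "ennreal (norm (\<phi> w) * (1 / norm (w - z)) + norm (\<phi> w) * (norm z / norm (1 - cnj w * z))) \<le> \<dots>" .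
  qed
  also have "\<dots> = ennreal (2 * \<tau> powr p / p) * 1 + ennreal (1 / (q * \<tau> powr q)) * ((\<integral>\<^sup>+w. ennreal (?f w) \<partial>dA) + (\<integral>\<^sup>+w. ennreal (?g w) \<partial>dA))"
    using m gm by (simp add: nn_integral_add nn_integral_cmult phi1)
  also have "\<dots> \<le> ennreal (2 * \<tau> powr p / p) * 1 + ennreal (1 / (q * \<tau> powr q)) * ennreal (2 * S)"
    using potential_bound[OF a z] unfolding S_def by (intro add_mono mult_left_mono) auto
  also have "\<dots> = ennreal (2 * \<tau> powr p / p + 1 / (q * \<tau> powr q) * (2 * S))"
    using p pq \<tau> S by (simp add: ennreal_mult[symmetric] ennreal_plus[symmetric] del: ennreal_plus)
  also have "2 * \<tau> powr p / p + 1 / (q * \<tau> powr q) * (2 * S) = 2 * S powr (1 / q)"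
  proof -
    have "S / S powr (1 / p) = S powr (1 / q)"
    proof -
      have "S powr (1 / q) * S powr (1 / p) = S powr 1"
        unfolding powr_add[symmetric] using pq(3) by (simp add: add.commute)
      then show ?thesis using S by (simp add: field_simps)
    qed
    then have "2 * \<tau> powr p / p + 1 / (q * \<tau> powr q) * (2 * S) = 2 * S powr (1 / q) * (1 / p + 1 / q)"
      unfolding \<tau>p \<tau>q by (simp add: distrib_left) (metis times_divide_eq_left times_divide_eq_right mult.commute divide_divide_eq_left)
    then show ?thesis using pq(3) by simp
  qed
  finally show "ennreal (norm (cauchyP \<phi> z)) \<le> ennreal (2 * hyper_sum (q / 2) powr (1 / q))"
    by (simp add: S_def)
qed

text \<open>The case q = 1: |\<phi>| is at most 1 almost everywhere, so Young's inequality is not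
  called for. Exponents are written as 2 times 1/2 to fit \<open>potential_bound\<close> at a =
  1/2.\<close>

lemma Linf_norm_cauchyP_le_Linf:
  assumes m: "\<phi> \<in> borel_measurable dA" and \<phi>: "Linf_norm \<phi> = 1"
  shows "Linf_norm (cauchyP \<phi>) \<le> ereal (2 * hyper_sum (1 / 2))"
proof (rule Linf_norm_cauchyP_le[OF m])
  show "0 \<le> 2 * hyper_sum (1 / 2)" using hyper_sum_pos[of "1 / 2"] by simp
  have ae: "AE w in dA. norm (\<phi> w) \<le> 1"
    using esssup_AE[of "\<lambda>w. ereal (norm (\<phi> w))" dA] \<phi> by (simp add: Linf_norm_def one_ereal_def)
  fix z :: complex assume z: "z \<noteq> 0" "norm z < 1"
  let ?f = "\<lambda>w. norm (w - z) powr (- 2 * (1 / 2))"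
  let ?g = "\<lambda>w. (norm z / norm (1 - cnj w * z)) powr (2 * (1 / 2))"
  have gm: "?g \<in> borel_measurable dA" "?f \<in> borel_measurable dA"
    using borel_measurable_cnj by (auto intro!: borel_measurable_dA)
  have "ennreal (norm (cauchyP \<phi> z)) \<le>
    (\<integral>\<^sup>+w. ennreal (norm (\<phi> w) * (1 / norm (w - z)) + norm (\<phi> w) * (norm z / norm (1 - cnj w * z))) \<partial>dA)"
    by (rule norm_cauchyP_le)
  also have "\<dots> \<le> (\<integral>\<^sup>+w. ennreal (?f w) + ennreal (?g w) \<partial>dA)"
  proof (rule nn_integral_mono_AE, use ae in eventually_elim)
    case (elim w)
    have "1 / norm (w - z) = ?f w" by (simp add: powr_minus_divide)
    moreover have "norm z / norm (1 - cnj w * z) = ?g w" by simp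
    moreover have "norm (\<phi> w) * y \<le> y" if "0 \<le> y" for y
      using elim that by (rule mult_left_le_one_le[rotated 2]) simp
    ultimately have "norm (\<phi> w) * (1 / norm (w - z)) + norm (\<phi> w) * (norm z / norm (1 - cnj w * z)) \<le> ?f w + ?g w"
      by (intro add_mono) (metis powr_ge_zero)+
    then have "ennreal (norm (\<phi> w) * (1 / norm (w - z)) + norm (\<phi> w) * (norm z / norm (1 - cnj w * z))) \<le> ennreal (?f w + ?g w)"
      by (rule ennreal_leI)
    also have "\<dots> = ennreal (?f w) + ennreal (?g w)" by (rule ennreal_plus) auto
    finally show ?case .
  qed
  also have "\<dots> = (\<integral>\<^sup>+w. ennreal (?f w) \<partial>dA) + (\<integral>\<^sup>+w. ennreal (?g w) \<partial>dA)"
    using gm by (intro nn_integral_add) auto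
  also have "\<dots> \<le> ennreal (2 * hyper_sum (1 / 2))"
    by (rule potential_bound[OF _ _ z]) auto
  finally show "ennreal (norm (cauchyP \<phi> z)) \<le> ennreal (2 * hyper_sum (1 / 2))" .
qed


section \<open>The lower bound\<close>

text \<open>A nonempty open part of the disk contains a ball, which has positive area, and so cannot
  consist of exceptional points only.\<close>

lemma AE_dA_witness:
  assumes "open U" "x \<in> U" "norm x < 1" and ae: "AE w in dA. P w"
  obtains w where "w \<in> U" "norm w < 1" "P w"
proof -
  have "open (U \<inter> ball 0 1)" "x \<in> U \<inter> ball 0 1" using assms by auto
  then obtain r where r: "0 < r" "ball x r \<subseteq> U \<inter> ball 0 1"
    by (meson open_contains_ball)
  have "\<exists>w\<in>ball x r. P w"
  proof (rule ccontr)
    assume "\<not> (\<exists>w\<in>ball x r. P w)"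
    with ae have ae': "AE w in dA. w \<notin> ball x r" by (auto elim!: eventually_mono)
    have b: "ball x r \<in> sets dA" using r by (intro emeasure_dA(1)) auto
    have s: "{w \<in> space dA. \<not> w \<notin> ball x r} = ball x r"
      using sets.sets_into_space[OF b] by blast
    have "emeasure dA (ball x r) = 0"
      by (rule iffD1[OF AE_iff_measurable[OF b s] ae'])
    moreover have "emeasure dA (ball x r) = ennreal (r\<^sup>2)"
      using r emeasure_ball[of r x] by (subst emeasure_dA(2)) (auto simp: unit_ball_vol_2 ennreal_mult[symmetric])
    ultimately show False using r by simp
  qed
  then obtain w where w: "w \<in> ball x r" "P w" by blast
  then have "w \<in> U \<inter> ball 0 1" using r by blast
  then show ?thesis using w by (intro that) auto
qed

text \<open>Since \<phi> vanishes near the unit circle, the kernel is bounded for z near 1 and the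
  transform is continuous there. Values close to the one at 1 are then taken on open pieces of the
  disk, which the essential supremum cannot miss.\<close>

lemma Linf_norm_cauchyP_ge_boundary:
  assumes m [measurable]: "\<phi> \<in> borel_measurable dA"
    and R: "0 < R" "R < 1"
    and bound: "\<And>w. norm (\<phi> w) \<le> M" and supp: "\<And>w. R \<le> norm w \<Longrightarrow> \<phi> w = 0"
  shows "ereal (norm (cauchyP \<phi> 1)) \<le> Linf_norm (cauchyP \<phi>)"
proof -
  \<comment> \<open>Half of the gap between the support and the circle: for z within \<delta> of 1
    and |w| < R, both denominators stay at least 1 - R - \<delta> = \<delta>.\<close>
  define \<delta> where "\<delta> = (1 - R) / 2"
  define U where "U = ball (1::complex) \<delta>"
  have \<delta>: "0 < \<delta>" "\<delta> < 1" using R by (auto simp: \<delta>_def)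
  have M: "0 \<le> M" using bound[of 0] norm_ge_zero order_trans by blast
  define k where "k z w = \<phi> w / (w - z) + z * cnj (\<phi> w) / (1 - cnj w * z)" for z w
  have idm [measurable]: "(\<lambda>w. w) \<in> dA \<rightarrow>\<^sub>M borel"
    by (rule borel_measurable_dA) simp
  note cm [measurable] = borel_measurable_cnj
  have km: "k z \<in> borel_measurable dA" for z
    unfolding k_def[abs_def] using measurable_compose[OF idm cm] measurable_compose[OF m cm] by measurable
  have den: "\<delta> \<le> norm (w - z)" "\<delta> \<le> norm (1 - cnj w * z)" "norm z \<le> 2" if z: "z \<in> U" and w: "norm w < R" for z w
  proof -
    have z1: "norm (1 - z) < \<delta>" using z by (simp add: U_def dist_norm)
    then have z2: "1 - \<delta> \<le> norm z" "norm z \<le> 1 + \<delta>"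
      using norm_triangle_ineq2[of 1 z] norm_triangle_ineq2[of z 1] by (auto simp: norm_minus_commute)
    then show "norm z \<le> 2" using \<delta> by simp
    have "norm z - norm w \<le> norm (w - z)" using norm_triangle_ineq2[of z w] by (simp add: norm_minus_commute)
    then show "\<delta> \<le> norm (w - z)" using z2 w by (simp add: \<delta>_def field_simps)
    have "norm (cnj w * z) \<le> R * (1 + \<delta>)"
      unfolding norm_mult using w z2 R by (intro mult_mono) auto
    also have "\<dots> \<le> R + \<delta>" using R \<delta> by (simp add: distrib_left mult_le_cancel_right1)
    finally have "norm (cnj w * z) \<le> R + \<delta>" .
    moreover have "1 - norm (cnj w * z) \<le> norm (1 - cnj w * z)" using norm_triangle_ineq2[of 1 "cnj w * z"] by simp
    ultimately show "\<delta> \<le> norm (1 - cnj w * z)" by (simp add: \<delta>_def field_simps)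
  qed
  have kb: "norm (k z w) \<le> M / \<delta> + 2 * M / \<delta>" if z: "z \<in> U" for z w
  proof (cases "norm w < R")
    case True
    note d = den[OF z True]
    have "norm (k z w) \<le> norm (\<phi> w) / norm (w - z) + norm z * norm (\<phi> w) / norm (1 - cnj w * z)"
      unfolding k_def by (rule order_trans[OF norm_triangle_ineq]) (simp add: norm_mult norm_divide)
    also have "\<dots> \<le> M / \<delta> + 2 * M / \<delta>"
      using d \<delta> M bound[of w] by (intro add_mono frac_le mult_mono) auto
    finally show ?thesis .
  next
    case False
    then show ?thesis using supp[of w] M \<delta> by (simp add: k_def)
  qed
  have lim: "(cauchyP \<phi> \<longlongrightarrow> cauchyP \<phi> 1) (at 1 within U)"
    unfolding tendsto_at_iff_sequentially
  proof (intro allI impI)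
    fix X :: "nat \<Rightarrow> complex" assume X: "\<forall>i. X i \<in> U - {1}" "X \<longlonglongrightarrow> 1"
    have "(\<lambda>i. LINT w|dA. k (X i) w) \<longlonglongrightarrow> (LINT w|dA. k 1 w)"
    proof (rule integral_dominated_convergence)
      show "AE w in dA. (\<lambda>i. k (X i) w) \<longlonglongrightarrow> k 1 w"
      proof (intro AE_I2)
        fix w assume "w \<in> space dA"
        then have w: "norm w < 1" by (simp add: space_dA)
        then have "w \<noteq> 1" by auto
        then have "w - 1 \<noteq> 0" "1 - cnj w * 1 \<noteq> 0" by simp_all
        then show "(\<lambda>i. k (X i) w) \<longlonglongrightarrow> k 1 w"
          unfolding k_def using X(2) by (intro tendsto_intros) auto
      qed
      show "AE w in dA. norm (k (X i) w) \<le> M / \<delta> + 2 * M / \<delta>" for i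
        using X(1) kb by (intro AE_I2) auto
    qed (use km in auto)
    then show "((cauchyP \<phi>) \<circ> X) \<longlonglongrightarrow> cauchyP \<phi> 1"
      unfolding cauchyP_def[abs_def] comp_def k_def by (rule tendsto_minus)
  qed
  have below: "ereal c \<le> Linf_norm (cauchyP \<phi>)" if "c < norm (cauchyP \<phi> 1)" for c
  proof -
    have "\<forall>\<^sub>F z in at 1 within U. c < norm (cauchyP \<phi> z)"
      using order_tendstoD(1)[OF tendsto_norm[OF lim] that] .
    then obtain d where d: "0 < d" "\<And>z. z \<in> U \<Longrightarrow> z \<noteq> 1 \<Longrightarrow> dist z 1 < d \<Longrightarrow> c < norm (cauchyP \<phi> z)"
      by (auto simp: eventually_at)
    define \<epsilon> where "\<epsilon> = min (min d \<delta>) 1 / 2"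
    have \<epsilon>: "0 < \<epsilon>" "\<epsilon> < d" "\<epsilon> < \<delta>" "\<epsilon> < 1" using d \<delta> by (auto simp: \<epsilon>_def)
    define V where "V = ball (1::complex) (min d \<delta>)"
    \<comment> \<open>The point 1 - \<epsilon> shows that the neighbourhood of 1 really meets the
      disk.\<close>
    have "1 - of_real (1 - \<epsilon>) = (of_real \<epsilon> :: complex)" by simp
    then have "dist 1 (of_real (1 - \<epsilon>) :: complex) = \<epsilon>"
      using \<epsilon>(1) by (simp only: dist_norm norm_of_real abs_of_pos)
    then have "open V" "of_real (1 - \<epsilon>) \<in> V" using \<epsilon> by (simp_all add: V_def)
    moreover have "norm (of_real (1 - \<epsilon>) :: complex) < 1"
      unfolding norm_of_real using \<epsilon> by simp
    moreover have "AE w in dA. ereal (norm (cauchyP \<phi> w)) \<le> Linf_norm (cauchyP \<phi>)"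
      unfolding Linf_norm_def by (rule esssup_AE)
    ultimately obtain w where w: "w \<in> V" "norm w < 1" "ereal (norm (cauchyP \<phi> w)) \<le> Linf_norm (cauchyP \<phi>)"
      by (rule AE_dA_witness)
    have "w \<noteq> 1" using w(2) by auto
    then have "c < norm (cauchyP \<phi> w)" using w(1) by (intro d(2)) (auto simp: V_def U_def dist_commute)
    then have "ereal c \<le> ereal (norm (cauchyP \<phi> w))" by simp
    also note w(3)
    finally show ?thesis .
  qed
  show ?thesis
  proof (rule dense_le)
    fix y assume y: "y < ereal (norm (cauchyP \<phi> 1))"
    show "y \<le> Linf_norm (cauchyP \<phi>)"
    proof (cases y)
      case (real c)
      then show ?thesis using below[of c] y by simp
    qed (use y in simp_all)
  qed
qed

text \<open>Equality in Hoelder's inequality for the kernel at the boundary point 1, cut off near the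
  boundary so that the kernel stays bounded and its integral is continuous there.\<close>

definition extremal :: "real \<Rightarrow> real \<Rightarrow> complex \<Rightarrow> complex" where
  "extremal q R w = (if norm w < R then \<i> * (1 - w) * of_real (norm (1 - w) powr (- q)) else 0)"

text \<open>A cut-off of U(1) for 0 <= R < 1. It is also half the modulus of the transform of
  \<open>extremal q R\<close> at 1 and, as (q - 1) p = q, the integral of |extremal|^p.\<close>

definition truncated_potential :: "real \<Rightarrow> real \<Rightarrow> real" where
  "truncated_potential q R = (LINT w|dA. norm (1 - w) powr (- q) * indicator (ball 0 R) w)"

lemma extremal_measurable: "extremal q R \<in> borel_measurable dA"
proof (rule borel_measurable_dA)
  show "extremal q R \<in> borel_measurable borel"
    unfolding extremal_def[abs_def] by measurable
qed

lemma norm_extremal: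
  assumes "R < 1"
  shows "norm (extremal q R w) = norm (1 - w) powr (1 - q) * indicator (ball 0 R) w"
proof (cases "norm w < R")
  case True
  then have "0 < norm (1 - w)" using assms by auto
  then have "norm (1 - w) * norm (1 - w) powr (- q) = norm (1 - w) powr (1 - q)"
    by (simp add: powr_diff powr_minus divide_inverse)
  then show ?thesis using True by (simp add: extremal_def norm_mult)
qed (simp add: extremal_def)

lemma norm_one_minus_powr_le:
  fixes w :: complex
  assumes "norm w < R" "R < 1" "s \<le> 0"
  shows "norm (1 - w) powr s \<le> (1 - R) powr s"
proof (rule powr_mono2')
  show "1 - R \<le> norm (1 - w)" using norm_triangle_ineq2[of 1 w] assms by simp
qed (use assms in auto)

text \<open>The factor \<i> in \<open>extremal\<close> decides the sign: with it both parts of the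
  kernel at 1 give - \<i> |1 - w|^(-q) and add up, whereas a real factor would make them
  cancel.\<close>

lemma cauchyP_extremal:
  assumes R: "0 < R" "R < 1" and q: "1 \<le> q" and c: "0 \<le> c"
  shows "ereal (2 * c * truncated_potential q R) \<le> Linf_norm (cauchyP (\<lambda>w. of_real c * extremal q R w))"
proof -
  let ?\<phi> = "\<lambda>w. of_real c * extremal q R w"
  have "?\<phi> w / (w - 1) + 1 * cnj (?\<phi> w) / (1 - cnj w * 1) = (- 2 * \<i> * of_real c) * of_real (norm (1 - w) powr (- q) * indicator (ball 0 R) w)" for w
  proof (cases "norm w < R")
    case True
    then have w: "w \<noteq> 1" using R by auto
    then have w': "1 - cnj w \<noteq> 0" using complex_cnj_cancel_iff[of w 1] by auto
    let ?y = "complex_of_real (norm (1 - w) powr (- q))"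
    have "?\<phi> w / (w - 1) = - \<i> * of_real c * ?y"
      using w True by (simp add: extremal_def field_simps)
    moreover have "cnj (?\<phi> w) / (1 - cnj w) = - \<i> * of_real c * ?y"
      using w' True by (simp add: extremal_def field_simps)
    ultimately show ?thesis using True by simp
  qed (simp add: extremal_def)
  then have "cauchyP ?\<phi> 1 = - (LINT w|dA. (- 2 * \<i> * of_real c) * of_real (norm (1 - w) powr (- q) * indicator (ball 0 R) w))"
    unfolding cauchyP_def by (simp only:)
  also have "\<dots> = 2 * \<i> * of_real c * of_real (truncated_potential q R)"
    unfolding truncated_potential_def by (subst integral_mult_right_zero) (simp del: of_real_mult)
  finally have P1: "cauchyP ?\<phi> 1 = 2 * \<i> * of_real c * of_real (truncated_potential q R)" .
  have "0 \<le> truncated_potential q R" unfolding truncated_potential_def by (intro integral_nonneg_AE) auto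
  then have "norm (cauchyP ?\<phi> 1) = 2 * c * truncated_potential q R"
    unfolding P1 using c by (simp add: norm_mult)
  moreover have "ereal (norm (cauchyP ?\<phi> 1)) \<le> Linf_norm (cauchyP ?\<phi>)"
  proof (rule Linf_norm_cauchyP_ge_boundary[OF _ R])
    show "?\<phi> \<in> borel_measurable dA" using extremal_measurable[of q R] by measurable
    show "norm (?\<phi> w) \<le> c * (1 - R) powr (1 - q)" for w
      using norm_one_minus_powr_le[of w R "1 - q"] R q c
      by (auto simp: norm_mult norm_extremal intro!: mult_left_mono split: split_indicator)
    show "?\<phi> w = 0" if "R \<le> norm w" for w using that by (simp add: extremal_def)
  qed
  ultimately show ?thesis by simp
qed

lemma truncated_potential_integrable:
  assumes "R < 1" "0 \<le> q"
  shows "integrable dA (\<lambda>w. norm (1 - w) powr (- q) * indicator (ball 0 R) w)"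
proof (rule dA.integrable_const_bound)
  have [measurable]: "ball 0 R \<in> sets (borel :: complex measure)" by simp
  show "(\<lambda>w. norm (1 - w) powr (- q) * indicator (ball 0 R) w) \<in> borel_measurable dA"
    by (intro borel_measurable_dA) measurable
  show "AE w in dA. norm (norm (1 - w) powr (- q) * indicator (ball 0 R) w) \<le> (1 - R) powr (- q)"
    using norm_one_minus_powr_le[of _ R "- q"] assms by (intro AE_I2) (auto split: split_indicator)
qed

text \<open>Monotone convergence to U(1), since the balls exhaust the disk.\<close>

lemma truncated_potential_tendsto:
  assumes q: "0 < q" "q < 2"
  shows "(\<lambda>n. truncated_potential q (1 - 1 / (real n + 2))) \<longlonglongrightarrow> hyper_sum (q / 2)"
proof -
  \<comment> \<open>The shift by 2 makes already the first radius positive, namely 1/2.\<close>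
  define R where "R n = 1 - 1 / (real n + 2)" for n :: nat
  have R1: "R n < 1" for n by (simp add: R_def)
  have Rm: "R m \<le> R n" if "m \<le> n" for m n using that by (simp add: R_def frac_le)
  let ?F = "\<lambda>n (w :: complex). ennreal (norm (1 - w) powr (- q)) * indicator (ball 0 (R n)) w"
  have "(SUP n. ?F n w) = ennreal (norm (1 - w) powr (- q))" if w: "norm w < 1" for w :: complex
  proof (rule antisym)
    have "R \<longlonglongrightarrow> 1" unfolding R_def[abs_def] by real_asymp
    from order_tendstoD(1)[OF this w] obtain n where "norm w < R n"
      by (auto simp: eventually_sequentially)
    then have "ennreal (norm (1 - w) powr (- q)) = ?F n w" by simp
    also have "\<dots> \<le> (SUP n. ?F n w)" by (rule SUP_upper) simp
    finally show "ennreal (norm (1 - w) powr (- q)) \<le> (SUP n. ?F n w)" .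
  qed (auto intro!: SUP_least split: split_indicator)
  then have "(\<integral>\<^sup>+w. (SUP n. ?F n w) \<partial>dA) = (\<integral>\<^sup>+w. ennreal (norm (1 - w) powr (- 2 * (q / 2))) \<partial>dA)"
    by (intro nn_integral_cong) (simp add: space_dA)
  also have "\<dots> = ennreal (hyper_sum (q / 2))"
    using q by (intro nn_integral_one_minus) auto
  finally have S: "(\<integral>\<^sup>+w. (SUP n. ?F n w) \<partial>dA) = ennreal (hyper_sum (q / 2))" .
  have inc: "incseq ?F"
  proof (rule incseq_SucI, rule le_funI)
    fix n w
    show "?F n w \<le> ?F (Suc n) w"
      using Rm[of n "Suc n"] by (auto split: split_indicator)
  qed
  have [measurable]: "ball 0 (R n) \<in> sets (borel :: complex measure)" for n by simp
  have Fm: "?F n \<in> borel_measurable dA" for n by (intro borel_measurable_dA) measurable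
  have "(\<lambda>n. \<integral>\<^sup>+w. ?F n w \<partial>dA) \<longlonglongrightarrow> (SUP n. \<integral>\<^sup>+w. ?F n w \<partial>dA)"
    using inc by (intro LIMSEQ_SUP incseq_nn_integral)
  also have "(SUP n. \<integral>\<^sup>+w. ?F n w \<partial>dA) = ennreal (hyper_sum (q / 2))"
    using nn_integral_monotone_convergence_SUP[OF inc Fm] S by simp
  also have "(\<lambda>n. \<integral>\<^sup>+w. ?F n w \<partial>dA) = (\<lambda>n. ennreal (truncated_potential q (R n)))"
  proof
    fix n
    have "?F n = (\<lambda>w. ennreal (norm (1 - w) powr (- q) * indicator (ball 0 (R n)) w))"
      by (auto split: split_indicator)
    then show "(\<integral>\<^sup>+w. ?F n w \<partial>dA) = ennreal (truncated_potential q (R n))"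
      unfolding truncated_potential_def using q R1 by (simp only:) (intro nn_integral_eq_integral truncated_potential_integrable; auto)
  qed
  finally have "(\<lambda>n. ennreal (truncated_potential q (R n))) \<longlonglongrightarrow> ennreal (hyper_sum (q / 2))" .
  moreover have "0 \<le> truncated_potential q (R n)" for n
    unfolding truncated_potential_def by (intro integral_nonneg_AE) auto
  moreover have "0 \<le> hyper_sum (q / 2)"
    using hyper_sum_pos[of "q / 2"] q by simp
  ultimately show ?thesis unfolding R_def by (subst (asm) tendsto_ennreal_iff) auto
qed

lemma Lp_norm_extremal:
  assumes p: "2 < p" and q: "q = p / (p - 1)" and R: "R < 1" and J: "0 < truncated_potential q R"
  defines "c \<equiv> truncated_potential q R powr (- 1 / p)"
  shows "in_Lp p (\<lambda>w. of_real c * extremal q R w)" "Lp_norm p (\<lambda>w. of_real c * extremal q R w) = 1"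
proof -
  note pq = conjugate_exponent[OF p, folded q]
  have cp: "c powr p = 1 / truncated_potential q R"
  proof -
    have "- 1 / p * p = - 1" using p by simp
    then have "c powr p = truncated_potential q R powr (- 1)" by (simp only: c_def powr_powr)
    then show ?thesis using J by (simp add: powr_minus_divide)
  qed
  have e: "norm (of_real c * extremal q R w) powr p = c powr p * (norm (1 - w) powr (- q) * indicator (ball 0 R) w)" for w
  proof -
    have "(1 - q) * p = - q" using pq(4) by (simp add: algebra_simps)
    then have "(norm (1 - w) powr (1 - q)) powr p = norm (1 - w) powr (- q)" by (simp add: powr_powr)
    then show ?thesis
      using R by (simp add: norm_mult norm_extremal powr_mult c_def split: split_indicator)
  qed
  show "in_Lp p (\<lambda>w. of_real c * extremal q R w)"
    unfolding in_Lp_def e using extremal_measurable[of q R] truncated_potential_integrable[OF R, of q] pq by auto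
  show "Lp_norm p (\<lambda>w. of_real c * extremal q R w) = 1"
    unfolding Lp_norm_def e using J cp by (simp add: truncated_potential_def[symmetric])
qed

text \<open>For q = 1 the modulus of \<open>extremal\<close> is the indicator of the smaller ball,
  so no normalizing constant is called for.\<close>

lemma Linf_norm_extremal:
  assumes R: "0 < R" "R < 1"
  shows "Linf_norm (extremal 1 R) = 1"
  unfolding Linf_norm_def
proof (rule antisym)
  have m: "(\<lambda>w. ereal (norm (extremal 1 R w))) \<in> borel_measurable dA"
    using extremal_measurable[of 1 R] by measurable
  have le: "norm (extremal 1 R w) = indicator (ball 0 R) w" for w
    using R by (auto simp: norm_extremal split: split_indicator)
  show "esssup dA (\<lambda>w. ereal (norm (extremal 1 R w))) \<le> 1"
    by (rule esssup_I[OF m]) (auto simp: le one_ereal_def split: split_indicator)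
  have "AE w in dA. ereal (norm (extremal 1 R w)) \<le> esssup dA (\<lambda>w. ereal (norm (extremal 1 R w)))"
    by (rule esssup_AE)
  then obtain w where "w \<in> ball 0 R" "ereal (norm (extremal 1 R w)) \<le> esssup dA (\<lambda>w. ereal (norm (extremal 1 R w)))"
    using AE_dA_witness[of "ball 0 R" 0] R by auto
  then show "1 \<le> esssup dA (\<lambda>w. ereal (norm (extremal 1 R w)))"
    by (simp add: le one_ereal_def)
qed

section \<open>The operator norms and their values\<close>

lemma opnorm_Lp_Linf_eq:
  assumes p: "2 < p" and q: "q = p / (p - 1)"
  shows "opnorm_Lp_Linf p = ereal (2 * hyper_sum (q / 2) powr (1 / q))"
proof (rule antisym)
  note pq = conjugate_exponent[OF p, folded q]
  show "opnorm_Lp_Linf p \<le> ereal (2 * hyper_sum (q / 2) powr (1 / q))"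
    unfolding opnorm_Lp_Linf_def using Linf_norm_cauchyP_le_Lp[OF p q] by (intro SUP_least) auto
  define R where "R n = 1 - 1 / (real n + 2)" for n :: nat
  have R: "0 < R n" "R n < 1" for n by (auto simp: R_def)
  have S: "0 < hyper_sum (q / 2)" using pq by (intro hyper_sum_pos) auto
  have lim: "(\<lambda>n. truncated_potential q (R n)) \<longlonglongrightarrow> hyper_sum (q / 2)"
    unfolding R_def using pq by (intro truncated_potential_tendsto) auto
  have "(\<lambda>n. ereal (2 * truncated_potential q (R n) powr (1 / q))) \<longlonglongrightarrow> ereal (2 * hyper_sum (q / 2) powr (1 / q))"
    using S lim by (intro tendsto_intros) auto
  then show "ereal (2 * hyper_sum (q / 2) powr (1 / q)) \<le> opnorm_Lp_Linf p"
  proof (rule tendsto_upperbound)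
    show "\<forall>\<^sub>F n in sequentially. ereal (2 * truncated_potential q (R n) powr (1 / q)) \<le> opnorm_Lp_Linf p"
      \<comment> \<open>Normalizing by the factor J^(-1/p) takes J > 0, which holds eventually
        because the limit is positive. The value 2 c J at the point 1 then equals 2 J^(1/q).\<close>
      using order_tendstoD(1)[OF lim S]
    proof eventually_elim
      case (elim n)
      define J where "J = truncated_potential q (R n)"
      define c where "c = J powr (- 1 / p)"
      have "2 * c * J = 2 * J powr (1 / q)"
      proof -
        have "c * J = J powr (- 1 / p) * J powr 1" using elim by (simp add: c_def J_def)
        also have "\<dots> = J powr (- 1 / p + 1)" by (rule powr_add[symmetric])
        also have "- 1 / p + 1 = 1 / q" using pq(3) by simp
        finally show ?thesis by simp
      qed
      moreover have "ereal (2 * c * J) \<le> Linf_norm (cauchyP (\<lambda>w. of_real c * extremal q (R n) w))"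
        unfolding J_def using pq by (intro cauchyP_extremal R) (auto simp: c_def)
      ultimately have "ereal (2 * J powr (1 / q)) \<le> Linf_norm (cauchyP (\<lambda>w. of_real c * extremal q (R n) w))"
        by (simp only:)
      also have "\<dots> \<le> opnorm_Lp_Linf p"
        unfolding opnorm_Lp_Linf_def using Lp_norm_extremal[OF p q R(2) elim]
        by (intro SUP_upper) (auto simp: c_def J_def)
      finally show ?case by (simp add: J_def)
    qed
  qed simp
qed

lemma opnorm_Linf_Linf_eq: "opnorm_Linf_Linf = ereal (2 * hyper_sum (1 / 2))"
proof (rule antisym)
  show "opnorm_Linf_Linf \<le> ereal (2 * hyper_sum (1 / 2))"
    unfolding opnorm_Linf_Linf_def using Linf_norm_cauchyP_le_Linf by (intro SUP_least) auto
  define R where "R n = 1 - 1 / (real n + 2)" for n :: nat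
  have R: "0 < R n" "R n < 1" for n by (auto simp: R_def)
  have lim: "(\<lambda>n. truncated_potential 1 (R n)) \<longlonglongrightarrow> hyper_sum (1 / 2)"
    unfolding R_def by (intro truncated_potential_tendsto) auto
  then have "(\<lambda>n. ereal (2 * truncated_potential 1 (R n))) \<longlonglongrightarrow> ereal (2 * hyper_sum (1 / 2))"
    by (intro tendsto_intros)
  then show "ereal (2 * hyper_sum (1 / 2)) \<le> opnorm_Linf_Linf"
  proof (rule tendsto_upperbound)
    show "\<forall>\<^sub>F n in sequentially. ereal (2 * truncated_potential 1 (R n)) \<le> opnorm_Linf_Linf"
    proof (intro always_eventually allI)
      fix n
      have "ereal (2 * truncated_potential 1 (R n)) \<le> Linf_norm (cauchyP (extremal 1 (R n)))"
        using cauchyP_extremal[OF R, of 1 1 n] by simp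
      also have "\<dots> \<le> opnorm_Linf_Linf"
        unfolding opnorm_Linf_Linf_def using Linf_norm_extremal[OF R] extremal_measurable
        by (intro SUP_upper) auto
      finally show "ereal (2 * truncated_potential 1 (R n)) \<le> opnorm_Linf_Linf" .
    qed
  qed simp
qed

lemma hyper_sum_half: "hyper_sum (1 / 2) = 4 / pi"
proof -
  have "Gamma (3 / 2 :: real) = sqrt pi / 2"
  proof -
    have "(1 / 2 :: real) \<notin> \<int>\<^sub>\<le>\<^sub>0" by (auto elim!: nonpos_Ints_cases)
    then show ?thesis
      using Gamma_plus1[of "1 / 2 :: real"] Gamma_one_half_real by simp
  qed
  moreover have "hyper_sum (1 / 2) = 1 / (Gamma (3 / 2))\<^sup>2"
    using hyper_sum_eq_Gamma[of "1 / 2"] by simp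
  ultimately show ?thesis by (simp only:) (simp add: power_divide)
qed

theorem theorem1p2:
  shows "(\<forall>p::real. p > 2 \<longrightarrow>
           (let q = p / (p - 1) in
            opnorm_Lp_Linf p = ereal (2 * (Gamma (2 - q) / (Gamma (2 - q / 2))\<^sup>2) powr (1 / q))))
         \<and> opnorm_Linf_Linf = ereal (8 / pi)"
proof (intro conjI allI impI)
  fix p :: real assume p: "2 < p"
  define q where "q = p / (p - 1)"
  have "hyper_sum (q / 2) = Gamma (2 - q) / (Gamma (2 - q / 2))\<^sup>2"
    using conjugate_exponent[OF p, folded q_def] hyper_sum_eq_Gamma[of "q / 2"] by simp
  then show "let q = p / (p - 1) in
      opnorm_Lp_Linf p = ereal (2 * (Gamma (2 - q) / (Gamma (2 - q / 2))\<^sup>2) powr (1 / q))"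
    using opnorm_Lp_Linf_eq[OF p q_def] by (simp add: Let_def q_def)
next
  show "opnorm_Linf_Linf = ereal (8 / pi)"
    using opnorm_Linf_Linf_eq by (simp add: hyper_sum_half)
qed

end
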